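(* Let $\mathbf{t}$ be the Tribonacci sequence, fixed point of $0\mapsto01$, $1\mapsto02$, $2\mapsto0$. Both first difference functions $(k,n)\mapsto\rho^{k+1}_{\mathbf{t}}(n)-\rho^k_{\mathbf{t}}(n)$ and $(k,n)\mapsto\rho^k_{\mathbf{t}}(n+1)-\rho^k_{\mathbf{t}}(n)$ are automatic in the Tribonacci numeration system, and thus bounded.
   Context: $u\sim_k v$ if $|u|_w=|v|_w$ for all words $w$ of length at most $k$; $\rho^k_{\mathbf{t}}(n)$ is the number of $\sim_k$-classes of length-$n$ factors of $\mathbf{t}$ ($k\ge1$, $n\ge0$). The Tribonacci numeration system represents integers by binary words without factor $111$, most significant digit first, $d_m\cdots d_0$ having value $\sum_i d_iT_i$ with $T_0=1,T_1=2,T_2=4$, $T_{i+3}=T_{i+2}+T_{i+1}+T_i$ (leading zeros allowed). A two-dimensional sequence is automatic in this system if a deterministic finite automaton with output, reading synchronously the representations of $k$ and $n$ padded with leading zeros to a common length, outputs its value at $(k,n)$. *)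

theory Defs
  imports Main
begin

fun trib_morph_letter :: "nat \<Rightarrow> nat list" where
  "trib_morph_letter x = (if x = 0 then [0,1] else if x = 1 then [0,2] else [0])"

definition trib_morph :: "nat list \<Rightarrow> nat list" where
  "trib_morph u = concat (map trib_morph_letter u)"

text \<open>The fixed point t = lim sigma^m(0); sigma^m(0) has length at least m+1,
  and each sigma^m(0) is a prefix of sigma^(m+1)(0), so the n-th letter is
  the n-th letter of sigma^(n+1)(0).\<close>
definition trib_word :: "nat \<Rightarrow> nat" where
  "trib_word n = ((trib_morph ^^ (Suc n)) [0]) ! n"

definition factors_of_len :: "(nat \<Rightarrow> 'a) \<Rightarrow> nat \<Rightarrow> 'a list set" where
  "factors_of_len x n = {map x [i..<i + n] | i. True}"

definition occ :: "'a list \<Rightarrow> 'a list \<Rightarrow> nat" where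
  "occ u w = card {i. i + length w \<le> length u \<and> take (length w) (drop i u) = w}"

definition k_abelian_eq :: "nat \<Rightarrow> 'a list \<Rightarrow> 'a list \<Rightarrow> bool" where
  "k_abelian_eq k u v \<longleftrightarrow> (\<forall>w. length w \<le> k \<longrightarrow> occ u w = occ v w)"

definition kab_complexity :: "(nat \<Rightarrow> 'a) \<Rightarrow> nat \<Rightarrow> nat \<Rightarrow> nat" where
  "kab_complexity x k n =
     card (factors_of_len x n //
           {(u, v). u \<in> factors_of_len x n \<and> v \<in> factors_of_len x n \<and> k_abelian_eq k u v})"

fun trib_num :: "nat \<Rightarrow> nat" where
  "trib_num 0 = 1"
| "trib_num (Suc 0) = 2"
| "trib_num (Suc (Suc 0)) = 4"
| "trib_num (Suc (Suc (Suc i))) = trib_num (Suc (Suc i)) + trib_num (Suc i) + trib_num i"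

fun trib_val :: "nat list \<Rightarrow> nat" where
  "trib_val [] = 0"
| "trib_val (d # ds) = d * trib_num (length ds) + trib_val ds"

definition trib_valid :: "nat list \<Rightarrow> bool" where
  "trib_valid ds \<longleftrightarrow> set ds \<subseteq> {0, 1} \<and> (\<nexists>a b. ds = a @ [1,1,1] @ b)"

text \<open>A DFAO over the alphabet of digit pairs: a finite state set Q (states are
  naturals), initial state q0 in Q, transition delta mapping Q into Q, and an
  output function. It computes f if, for every pair of valid representations
  u, v of equal length (i.e. representations padded with leading zeros to a
  common length) of k and n, the output at the reached state is f k n.
  The domain of f is restricted by the predicate D.\<close>
definition trib_automatic2 :: "(nat \<Rightarrow> nat \<Rightarrow> bool) \<Rightarrow> (nat \<Rightarrow> nat \<Rightarrow> 'b) \<Rightarrow> bool" where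
  "trib_automatic2 D f \<longleftrightarrow>
     (\<exists>(Q :: nat set) q0 (delta :: nat \<Rightarrow> nat \<times> nat \<Rightarrow> nat) (out :: nat \<Rightarrow> 'b).
        finite Q \<and> q0 \<in> Q \<and>
        (\<forall>q\<in>Q. \<forall>a b. a \<in> {0,1} \<longrightarrow> b \<in> {0,1} \<longrightarrow> delta q (a, b) \<in> Q) \<and>
        (\<forall>k n u v. D k n \<longrightarrow> trib_valid u \<longrightarrow> trib_valid v \<longrightarrow> length u = length v \<longrightarrow>
            trib_val u = k \<longrightarrow> trib_val v = n \<longrightarrow>
            out (foldl delta q0 (zip u v)) = f k n))"

end

theory Submission
  imports Defs Complex_Main
begin

text \<open>By the desubstitution of the Tribonacci word every length has only one left special factor,
  and therefore two factors of length n are k-abelian equivalent iff they are abelian equivalent and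
  agree on their prefixes and suffixes of length min(k - 1, n). This makes the equivalence definable
  from addition and from the map sending n to the length of the image of the prefix of length n.
  Both have finite-state graphs on all binary (not only greedy) representations, because the
  Tribonacci constant is a Pisot number; and relations with finite-state graphs are closed under
  first-order operations, which is immediate when ``finite-state'' is expressed by finitely many
  residuals.

  Each difference in question counts classes that split, up to a difference of two such counts. A
  class splits only at a special prefix or suffix, and there are at most two special words of each
  length. By synchronization a window of length h sits at a fixed offset to the blocks of a level
  of size about h, and letter counts are balanced, so once the window is fixed, the window at any
  given distance and the letter counts between the two take boundedly many values. Hence the counts are
  bounded, and bounded counts of definable sets are definable.\<close>

subsection \<open>The Tribonacci word and its desubstitution\<close>

text \<open>An automaton with output has finitely many values, so it cannot compute two complexities
  and subtract them; the difference must itself be a count. Therefore each class is represented by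
  the least position at which one of its factors starts: refining the equivalence only adds
  representatives, and a difference becomes the size of a set of numbers that quantifiers over
  positions describe. Admitting every binary word as a representation removes normal forms: sums and
  projected witnesses never have to be made greedy, and a longer witness costs only leading zeros.
  The price is that linear relations must be finite-state on words with arbitrary runs of 1; the
  Pisot estimate gives this for any bounded digits. Fixing a special prefix does not yet bound the
  splitting classes, since the suffix lies far away. Comparing positions directly is too coarse;
  both ends are located by block indices at a level whose blocks match the window length, where a
  bounded error leaves boundedly many choices.\<close>

definition trib_prefix :: "nat \<Rightarrow> nat list" where
  "trib_prefix n = map trib_word [0..<n]"

text \<open>The start of the image of the n-th letter. As every image contains exactly one 0, at its
  front, this is also the position of the n-th 0, counted from 0.\<close>

definition sub_len :: "nat \<Rightarrow> nat" where
  "sub_len n = length (trib_morph (trib_prefix n))"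

lemma trib_morph_append: "trib_morph (u @ v) = trib_morph u @ trib_morph v"
  by (simp add: trib_morph_def)

lemma trib_morph_pow_Suc: "\<exists>v. v \<noteq> [] \<and> (trib_morph ^^ Suc m) [0] = (trib_morph ^^ m) [0] @ v"
proof (induction m)
  case 0
  show ?case by (simp add: trib_morph_def)
next
  case (Suc m)
  then obtain v where v: "v \<noteq> []" "(trib_morph ^^ Suc m) [0] = (trib_morph ^^ m) [0] @ v" by blast
  have "(trib_morph ^^ Suc (Suc m)) [0] = trib_morph ((trib_morph ^^ Suc m) [0])" by simp
  also have "\<dots> = (trib_morph ^^ Suc m) [0] @ trib_morph v"
    by (subst v(2)) (simp add: trib_morph_append)
  finally have "(trib_morph ^^ Suc (Suc m)) [0] = (trib_morph ^^ Suc m) [0] @ trib_morph v" .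
  moreover have "trib_morph v \<noteq> []"
    using v(1) by (cases v) (auto simp: trib_morph_def)
  ultimately show ?case by blast
qed

lemma length_trib_morph_pow: "m < length ((trib_morph ^^ m) [0])"
proof (induction m)
  case (Suc m)
  then show ?case using trib_morph_pow_Suc[of m] by (auto simp del: funpow.simps simp: neq_Nil_conv)
qed simp

lemma trib_morph_pow_add: "\<exists>v. (trib_morph ^^ (m + d)) [0] = (trib_morph ^^ m) [0] @ v"
proof (induction d)
  case (Suc d)
  then show ?case using trib_morph_pow_Suc[of "m + d"] by (auto simp del: funpow.simps)
qed simp

lemma trib_morph_pow_nth:
  assumes "n < length ((trib_morph ^^ m) [0])"
  shows "(trib_morph ^^ m) [0] ! n = trib_word n"
proof -
  have 1: "n < length ((trib_morph ^^ Suc n) [0])"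
    using length_trib_morph_pow[of "Suc n"] by (simp del: funpow.simps)
  obtain v where v: "(trib_morph ^^ (m + Suc n)) [0] = (trib_morph ^^ m) [0] @ v"
    using trib_morph_pow_add by blast
  obtain v' where v': "(trib_morph ^^ (m + Suc n)) [0] = (trib_morph ^^ Suc n) [0] @ v'"
    using trib_morph_pow_add[of "Suc n" m] by (metis add.commute)
  have "(trib_morph ^^ m) [0] ! n = (trib_morph ^^ (m + Suc n)) [0] ! n"
    using assms by (simp only: v nth_append if_True)
  also have "\<dots> = (trib_morph ^^ Suc n) [0] ! n"
    using 1 by (simp only: v' nth_append if_True)
  finally show ?thesis by (simp only: trib_word_def)
qed

lemma trib_morph_pow_prefix:
  "(trib_morph ^^ m) [0] = trib_prefix (length ((trib_morph ^^ m) [0]))"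
  by (rule nth_equalityI) (auto simp: trib_prefix_def trib_morph_pow_nth)

lemma trib_prefix_add: "trib_prefix (n + d) = trib_prefix n @ map trib_word [n..<n+d]"
  by (simp add: trib_prefix_def upt_add_eq_append[of 0 n d, simplified])

text \<open>The fixed point property for finite prefixes: the prefix of length n begins
  \<open>(trib_morph ^^ n) [0]\<close>, so its image begins the next iterate, which is again a
  prefix of the word.\<close>

lemma trib_morph_prefix: "trib_morph (trib_prefix n) = trib_prefix (sub_len n)"
proof -
  let ?W = "(trib_morph ^^ n) [0]"
  obtain d where d: "length ?W = n + d"
    using length_trib_morph_pow[of n] by (metis less_imp_add_positive)
  define r where "r = map trib_word [n..<n+d]"
  have W: "?W = trib_prefix n @ r"
    using trib_morph_pow_prefix[of n] unfolding d trib_prefix_add r_def .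
  have "(trib_morph ^^ Suc n) [0] = trib_morph (trib_prefix n) @ trib_morph r"
    by (simp add: W trib_morph_append)
  then have 1: "trib_prefix (length ((trib_morph ^^ Suc n) [0])) = trib_morph (trib_prefix n) @ trib_morph r"
    using trib_morph_pow_prefix[of "Suc n"] by metis
  have 2: "length ((trib_morph ^^ Suc n) [0]) = sub_len n + length (trib_morph r)"
    by (simp add: W trib_morph_append sub_len_def)
  show ?thesis
    using 1 unfolding 2 trib_prefix_add
    by (subst (asm) append_eq_append_conv) (auto simp: sub_len_def trib_prefix_def)
qed

lemma sub_len_0 [simp]: "sub_len 0 = 0"
  by (simp add: sub_len_def trib_prefix_def trib_morph_def)

lemma trib_morph_prefix_Suc:
  "trib_prefix (sub_len (Suc n)) = trib_prefix (sub_len n) @ trib_morph_letter (trib_word n)"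
proof -
  have "trib_prefix (Suc n) = trib_prefix n @ [trib_word n]" by (simp add: trib_prefix_def)
  then show ?thesis
    by (simp add: trib_morph_append trib_morph_def flip: trib_morph_prefix)
qed

lemma sub_len_Suc_length: "sub_len (Suc n) = sub_len n + length (trib_morph_letter (trib_word n))"
  using arg_cong[OF trib_morph_prefix_Suc[of n], of length]
  by (simp add: trib_prefix_def del: trib_morph_letter.simps)

lemma trib_word_block:
  assumes "x < length (trib_morph_letter (trib_word n))"
  shows "trib_word (sub_len n + x) = trib_morph_letter (trib_word n) ! x"
proof -
  have l: "sub_len n + x < sub_len (Suc n)" using assms by (simp only: sub_len_Suc_length)
  have "trib_prefix (sub_len (Suc n)) ! (sub_len n + x) = trib_word (sub_len n + x)"
    using l by (simp add: trib_prefix_def)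
  moreover have "(trib_prefix (sub_len n) @ trib_morph_letter (trib_word n)) ! (sub_len n + x)
      = trib_morph_letter (trib_word n) ! x"
    by (simp add: nth_append trib_prefix_def del: trib_morph_letter.simps)
  ultimately show ?thesis by (simp only: trib_morph_prefix_Suc)
qed

lemma trib_word_le_2: "trib_word n \<le> 2"
proof -
  have "\<forall>a\<in>set ((trib_morph ^^ m) [0]). a \<le> 2" for m
    by (induction m) (auto simp: trib_morph_def split: if_splits)
  then show ?thesis
    using length_trib_morph_pow[of "Suc n"] unfolding trib_word_def
    by (metis Suc_lessD nth_mem)
qed

lemma trib_word_cases: "trib_word n = 0 \<or> trib_word n = 1 \<or> trib_word n = 2"
  using trib_word_le_2[of n] by linarith

lemma trib_word_mem: "trib_word n \<in> {0, 1, 2}"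
  using trib_word_cases by auto

lemma sub_len_Suc: "sub_len (Suc n) = sub_len n + (if trib_word n = 2 then 1 else 2)"
  using trib_word_cases[of n] by (auto simp: sub_len_Suc_length)

lemma trib_word_sub_len [simp]: "trib_word (sub_len n) = 0"
  using trib_word_block[of 0 n] by (auto split: if_splits)

lemma trib_word_sub_len_Suc:
  "trib_word (Suc (sub_len n)) = (if trib_word n = 0 then 1 else if trib_word n = 1 then 2 else 0)"
proof (cases "trib_word n = 2")
  case True
  then have "Suc (sub_len n) = sub_len (Suc n)" by (simp add: sub_len_Suc)
  then show ?thesis using True by (metis One_nat_def numeral_2_eq_2 n_not_Suc_n trib_word_sub_len zero_neq_numeral)
next
  case False
  then show ?thesis using trib_word_block[of 1 n] trib_word_cases[of n] by auto
qed

lemma sub_len_strict_mono: "strict_mono sub_len"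
  by (auto simp: strict_mono_Suc_iff sub_len_Suc)

lemma sub_len_less_iff [simp]: "sub_len a < sub_len b \<longleftrightarrow> a < b"
  using sub_len_strict_mono by (rule strict_mono_less)

lemma sub_len_le_iff [simp]: "sub_len a \<le> sub_len b \<longleftrightarrow> a \<le> b"
  using sub_len_strict_mono by (rule strict_mono_less_eq)

lemma le_sub_len: "n \<le> sub_len n"
  using sub_len_strict_mono by (rule strict_mono_imp_increasing)

lemma sub_len_cases:
  obtains j where "x = sub_len j" | j where "x = Suc (sub_len j)" "trib_word j \<noteq> 2"
proof -
  have "(\<exists>j. x = sub_len j) \<or> (\<exists>j. x = Suc (sub_len j) \<and> trib_word j \<noteq> 2)"
  proof (induction x)
    case 0
    have "0 = sub_len 0" by simp
    then show ?case by blast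
  next
    case (Suc x)
    then show ?case
    proof (elim disjE exE conjE)
      fix j assume j: "x = sub_len j"
      show ?case
      proof (cases "trib_word j = 2")
        case True
        then have "Suc x = sub_len (Suc j)" by (simp add: j sub_len_Suc)
        then show ?thesis by blast
      qed (use j in blast)
    next
      fix j assume j: "x = Suc (sub_len j)" "trib_word j \<noteq> 2"
      then have "Suc x = sub_len (Suc j)" by (simp add: sub_len_Suc)
      then show ?case by blast
    qed
  qed
  then show ?thesis using that by blast
qed

lemma trib_word_eq_0_iff: "trib_word x = 0 \<longleftrightarrow> (\<exists>j. x = sub_len j)"
proof (cases x rule: sub_len_cases)
  case (2 j)
  have "x \<noteq> sub_len i" for i
  proof
    assume "x = sub_len i"
    moreover have "sub_len j < x" "x < sub_len (Suc j)" using 2 by (auto simp: sub_len_Suc)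
    ultimately show False by simp
  qed
  then show ?thesis using 2 trib_word_cases[of j] by (auto simp: trib_word_sub_len_Suc)
qed auto

text \<open>A 1 arises only as the second letter of the image of a 0, and zeros are the block
  starts. Letters thus become expressible through \<open>sub_len\<close> and successor.\<close>

lemma trib_word_eq_1_iff: "trib_word x = 1 \<longleftrightarrow> (\<exists>j. x = Suc (sub_len (sub_len j)))"
proof
  assume x: "trib_word x = 1"
  show "\<exists>j. x = Suc (sub_len (sub_len j))"
  proof (cases x rule: sub_len_cases)
    case (2 j)
    then have "trib_word j = 0"
      using x by (auto simp: trib_word_sub_len_Suc split: if_splits)
    then obtain i where "j = sub_len i" unfolding trib_word_eq_0_iff by blast
    then show ?thesis using 2(1) by blast
  qed (use x in auto)
qed (auto simp: trib_word_sub_len_Suc)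

text \<open>Cayley-Hamilton for the incidence matrix, in terms of lengths: three steps map 0, 1, 2
  to words of lengths 7 = 4 + 2 + 1, 6 = 3 + 2 + 1 and 4 = 2 + 1 + 1.\<close>

lemma sub_len_3: "sub_len (sub_len (sub_len n)) = sub_len (sub_len n) + sub_len n + n"
proof (induction n)
  case (Suc n)
  consider (0) "trib_word n = 0" | (1) "trib_word n = 1" | (2) "trib_word n = 2"
    using trib_word_cases[of n] by metis
  then show ?case
  proof cases
    case 0
    have a: "sub_len (Suc n) = Suc (Suc (sub_len n))" by (simp add: sub_len_Suc 0)
    have t1: "trib_word (Suc (sub_len n)) = 1" by (simp add: trib_word_sub_len_Suc 0)
    have b: "sub_len (Suc (sub_len n)) = Suc (Suc (sub_len (sub_len n)))"
      "sub_len (sub_len (Suc n)) = sub_len (sub_len n) + 4"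
      unfolding a by (simp_all add: sub_len_Suc t1)
    have "trib_word (Suc (sub_len (sub_len n))) = 1"
      "trib_word (Suc (Suc (sub_len (sub_len n)))) = 0"
      "trib_word (Suc (Suc (Suc (sub_len (sub_len n))))) = 2"
      using t1 by (simp_all add: trib_word_sub_len_Suc flip: b(1))
    then have "sub_len (sub_len (sub_len n) + 4) = sub_len (sub_len (sub_len n)) + 7"
      by (simp add: eval_nat_numeral sub_len_Suc)
    then show ?thesis using Suc b(2) a by simp
  next
    case 1
    have a: "sub_len (Suc n) = Suc (Suc (sub_len n))" by (simp add: sub_len_Suc 1)
    have t1: "trib_word (Suc (sub_len n)) = 2" by (simp add: trib_word_sub_len_Suc 1)
    have b: "sub_len (Suc (sub_len n)) = Suc (Suc (sub_len (sub_len n)))"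
      "sub_len (sub_len (Suc n)) = sub_len (sub_len n) + 3"
      unfolding a by (simp_all add: sub_len_Suc t1)
    have "trib_word (Suc (sub_len (sub_len n))) = 1"
      "trib_word (Suc (Suc (sub_len (sub_len n)))) = 0"
      by (simp_all add: trib_word_sub_len_Suc flip: b(1))
    then have "sub_len (sub_len (sub_len n) + 3) = sub_len (sub_len (sub_len n)) + 6"
      by (simp add: eval_nat_numeral sub_len_Suc)
    then show ?thesis using Suc b(2) a by simp
  next
    case 2
    have a: "sub_len (Suc n) = Suc (sub_len n)" by (simp add: sub_len_Suc 2)
    have b: "sub_len (sub_len (Suc n)) = Suc (Suc (sub_len (sub_len n)))"
      unfolding a by (simp add: sub_len_Suc)
    have "trib_word (Suc (sub_len (sub_len n))) = 1" by (simp add: trib_word_sub_len_Suc)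
    then have "sub_len (Suc (Suc (sub_len (sub_len n)))) = sub_len (sub_len (sub_len n)) + 4"
      by (simp add: sub_len_Suc)
    then show ?thesis using Suc b a by simp
  qed
qed simp

subsection \<open>Binary representations\<close>

lemma trib_val_append:
  "trib_val (u @ v) = trib_val (u @ replicate (length v) 0) + trib_val v"
proof (induction u)
  case Nil
  have "trib_val (replicate m 0) = 0" for m by (induction m) auto
  then show ?case by simp
qed auto

lemma trib_val_replicate_0 [simp]: "trib_val (replicate m 0 @ u) = trib_val u"
  by (induction m) auto

lemma trib_val_snoc: "trib_val (u @ [d]) = trib_val (u @ [0]) + d"
  using trib_val_append[of u "[d]"] by simp

lemma trib_val_shift_3:
  "trib_val (u @ [0, 0, 0]) = trib_val (u @ [0, 0]) + trib_val (u @ [0]) + trib_val u"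
proof (induction u)
  case (Cons d u)
  have "trib_num (length u + 3) = trib_num (length u + 2) + trib_num (length u + 1) + trib_num (length u)"
    by (simp add: eval_nat_numeral)
  then show ?case using Cons by (simp add: algebra_simps)
qed simp

text \<open>No greediness is needed here: sub_len shifts every binary representation,
  even one containing the factor 111.\<close>
lemma sub_len_trib_val:
  assumes "set u \<subseteq> {0, 1}"
  shows "sub_len (trib_val u) = trib_val (u @ [0])"
proof -
  \<comment> \<open>One and two shifts are carried along together, because the recurrence yields the
    third shift of u, needed for \<open>u @ [d]\<close>, from the first two.\<close>
  have "sub_len (trib_val u) = trib_val (u @ [0]) \<and>
      sub_len (sub_len (trib_val u)) = trib_val (u @ [0, 0])"
    using assms
  proof (induction u rule: rev_induct)
    case (snoc d u)
    define n where "n = trib_val u"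
    have IH: "trib_val (u @ [0]) = sub_len n" "trib_val (u @ [0, 0]) = sub_len (sub_len n)"
      using snoc by (auto simp: n_def)
    have 3: "trib_val (u @ [0, 0, 0]) = sub_len (sub_len (sub_len n))"
      by (simp only: trib_val_shift_3 IH sub_len_3 n_def[symmetric])
    have v: "trib_val (u @ [d]) = sub_len n + d"
      using trib_val_append[of u "[d]"] IH by (simp add: eval_nat_numeral)
    have v1: "trib_val (u @ [d, 0]) = sub_len (sub_len n) + d * 2"
      using trib_val_append[of u "[d, 0]"] IH by (simp add: eval_nat_numeral)
    have v2: "trib_val (u @ [d, 0, 0]) = sub_len (sub_len (sub_len n)) + d * 4"
      using trib_val_append[of u "[d, 0, 0]"] 3 by (simp add: eval_nat_numeral)
    consider "d = 0" | "d = 1" using snoc.prems by auto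
    then show ?case
    proof cases
      case 2
      \<comment> \<open>The digit 1 appends the letter 0 at position \<open>sub_len n\<close>, whose
        images 01 and 0102 have lengths \<open>trib_num 1\<close> and
        \<open>trib_num 2\<close>.\<close>
      have a: "sub_len (Suc (sub_len n)) = Suc (Suc (sub_len (sub_len n)))"
        by (simp add: sub_len_Suc)
      have t: "trib_word (Suc (sub_len (sub_len n))) = 1"
        by (simp add: trib_word_sub_len_Suc)
      have "sub_len (Suc (Suc (sub_len (sub_len n)))) = sub_len (sub_len (sub_len n)) + 4"
        by (simp add: sub_len_Suc t)
      then show ?thesis using 2 v v1 v2 a by simp
    qed (use v v1 v2 in simp)
  qed simp
  then show ?thesis by blast
qed

text \<open>Desubstitution produces the digits: n is \<open>sub_len j\<close> plus a digit d, and
  appending d to a representation of j shifts its value to \<open>sub_len j\<close> and adds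
  d.\<close>

lemma trib_val_surj: "\<exists>u. set u \<subseteq> {0, 1} \<and> trib_val u = n"
proof (induction n rule: less_induct)
  case (less n)
  have step: "\<exists>u. set u \<subseteq> {0, 1} \<and> trib_val u = sub_len j + d" if j: "j < n" and d: "d \<le> 1" for j d
  proof -
    obtain u where u: "set u \<subseteq> {0, 1}" "trib_val u = j" using less[OF j] by blast
    have "trib_val (u @ [d]) = sub_len j + d"
      using sub_len_trib_val[OF u(1)] u(2) by (subst trib_val_snoc) simp
    moreover have "set (u @ [d]) \<subseteq> {0, 1}" using u d by auto
    ultimately show ?thesis by blast
  qed
  show ?case
  proof (cases "n = 0")
    case True
    then show ?thesis by (intro exI[of _ "[]"]) simp
  next
    case False
    show ?thesis
    proof (cases n rule: sub_len_cases)
      case (1 j)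
      have "0 < j" using 1 False by (cases j) auto
      moreover have "j < sub_len j" if "0 < j" for j
        using that
      proof (induction j)
        case (Suc j)
        show ?case
        proof (cases "j = 0")
          case True
          have "trib_word 0 = 0" using trib_word_sub_len[of 0] by simp
          then show ?thesis using True by (simp add: sub_len_Suc)
        qed (use Suc in \<open>simp add: sub_len_Suc\<close>)
      qed simp
      ultimately show ?thesis using step[of j 0] 1 by simp
    next
      case (2 j)
      then show ?thesis using step[of j 1] le_sub_len[of j] by simp
    qed
  qed
qed

subsection \<open>Letter counts\<close>

definition letter_count :: "nat \<Rightarrow> nat \<Rightarrow> nat" where
  "letter_count a n = card {l. l < n \<and> trib_word l = a}"

lemma letter_count_0 [simp]: "letter_count a 0 = 0"
  by (simp add: letter_count_def)

lemma letter_count_Suc: "letter_count a (Suc n) = letter_count a n + (if trib_word n = a then 1 else 0)"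
proof -
  have "{l. l < Suc n \<and> trib_word l = a} =
      (if trib_word n = a then insert n {l. l < n \<and> trib_word l = a} else {l. l < n \<and> trib_word l = a})"
    by (auto simp: less_Suc_eq)
  then show ?thesis by (simp add: letter_count_def)
qed

lemma letter_count_mono: "m \<le> n \<Longrightarrow> letter_count a m \<le> letter_count a n"
  by (rule lift_Suc_mono_le[of "letter_count a"]) (simp_all add: letter_count_Suc)

lemma letter_count_sum: "letter_count 0 n + letter_count 1 n + letter_count 2 n = n"
proof (induction n)
  case (Suc n)
  then show ?case using trib_word_cases[of n] by (auto simp: letter_count_Suc)
qed simp

lemma letter_count_sub_len:
  "letter_count 0 (sub_len n) = n"
  "letter_count 1 (sub_len n) = letter_count 0 n"
  "letter_count 2 (sub_len n) = letter_count 1 n"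
proof -
  have "letter_count 0 (sub_len n) = n \<and> letter_count 1 (sub_len n) = letter_count 0 n
      \<and> letter_count 2 (sub_len n) = letter_count 1 n"
  proof (induction n)
    case (Suc n)
    then show ?case using trib_word_cases[of n]
      by (auto simp: sub_len_Suc letter_count_Suc trib_word_sub_len_Suc)
  qed simp
  then show "letter_count 0 (sub_len n) = n" "letter_count 1 (sub_len n) = letter_count 0 n"
    "letter_count 2 (sub_len n) = letter_count 1 n" by auto
qed

lemma letter_count_window_cong:
  assumes "\<forall>l<h. trib_word (i + l) = trib_word (j + l)"
  shows "int (letter_count a (i + h)) - int (letter_count a i) =
    int (letter_count a (j + h)) - int (letter_count a j)"
  using assms by (induction h) (auto simp: letter_count_Suc)

subsection \<open>Windows\<close>

definition window :: "nat \<Rightarrow> nat \<Rightarrow> nat list" where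
  "window i h = map trib_word [i..<i + h]"

lemma length_window [simp]: "length (window i h) = h"
  by (simp add: window_def)

lemma window_nth [simp]: "l < h \<Longrightarrow> window i h ! l = trib_word (i + l)"
  by (simp add: window_def)

lemma window_eq_iff: "window i h = window j h \<longleftrightarrow> (\<forall>l<h. trib_word (i + l) = trib_word (j + l))"
  by (auto simp: list_eq_iff_nth_eq)

lemma window_0 [simp]: "window i 0 = []"
  by (simp add: window_def)

lemma window_Suc: "window i (Suc h) = trib_word i # window (Suc i) h"
  by (auto simp: window_def upt_conv_Cons simp del: upt_Suc)

lemma window_snoc: "window i (Suc h) = window i h @ [trib_word (i + h)]"
  by (simp add: window_def)

lemma set_window: "set (window i h) \<subseteq> {0, 1, 2}"
  unfolding window_def set_map by (rule image_subsetI, rule trib_word_mem)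

lemma finite_windows: "finite (range (\<lambda>i. window i h))"
proof (rule finite_subset)
  show "range (\<lambda>i. window i h) \<subseteq> {w. set w \<subseteq> {0, 1, 2} \<and> length w = h}"
    using set_window by fastforce
qed (rule finite_lists_length_eq, simp)

lemma card_windows_le: "card (range (\<lambda>i. window i h)) \<le> 3 ^ h"
proof -
  have "range (\<lambda>i. window i h) \<subseteq> {w. set w \<subseteq> {0, 1, 2} \<and> length w = h}"
    using set_window by fastforce
  then have "card (range (\<lambda>i. window i h)) \<le> card {w. set w \<subseteq> {0, 1, 2::nat} \<and> length w = h}"
    by (intro card_mono finite_lists_length_eq) auto
  then show ?thesis by (simp add: card_lists_length_eq numeral_3_eq_3)
qed

section \<open>Images and preimages of windows\<close>

lemma sub_len_mono: "m \<le> n \<Longrightarrow> sub_len m \<le> sub_len n"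
  by simp

text \<open>The bound on x is not strict: whatever follows the images of the c letters begins with a
  0.\<close>

lemma sub_len_window_cong:
  assumes "\<forall>l<c. trib_word (j + l) = trib_word (j' + l)"
  shows "sub_len (j + c) - sub_len j = sub_len (j' + c) - sub_len j' \<and>
    (\<forall>x\<le>sub_len (j + c) - sub_len j. trib_word (sub_len j + x) = trib_word (sub_len j' + x))"
  using assms
proof (induction c)
  case (Suc c)
  let ?d = "sub_len (j + c) - sub_len j"
  have IH: "?d = sub_len (j' + c) - sub_len j'"
    "\<forall>x\<le>?d. trib_word (sub_len j + x) = trib_word (sub_len j' + x)"
    and t: "trib_word (j + c) = trib_word (j' + c)"
    using Suc by auto
  have e: "sub_len (j + c) = sub_len j + ?d" "sub_len (j' + c) = sub_len j' + ?d"
    using IH(1) sub_len_mono[of j "j + c"] sub_len_mono[of j' "j' + c"] by linarith+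
  have d: "sub_len (j + Suc c) - sub_len j = ?d + (if trib_word (j + c) = 2 then 1 else 2)"
    "sub_len (j' + Suc c) - sub_len j' = ?d + (if trib_word (j + c) = 2 then 1 else 2)"
    using IH(1) t sub_len_mono[of j "j + c"] sub_len_mono[of j' "j' + c"] by (simp_all add: sub_len_Suc Suc_diff_le del: sub_len_le_iff)
  have "trib_word (sub_len j + x) = trib_word (sub_len j' + x)" if "x \<le> sub_len (j + Suc c) - sub_len j" for x
  proof -
    have "x \<le> y \<or> x = Suc y \<or> x = Suc (Suc y) \<and> trib_word (j + c) \<noteq> 2"
      if "x \<le> y + (if trib_word (j + c) = 2 then 1 else 2)" for y
      using that by (auto split: if_splits)
    from this[OF that[unfolded d]]
    have "x \<le> ?d \<or> x = Suc ?d \<or> x = Suc (Suc ?d) \<and> trib_word (j + c) \<noteq> 2" .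
    then consider "x \<le> ?d" | "x = Suc ?d" | "x = Suc (Suc ?d)" "trib_word (j + c) \<noteq> 2" by metis
    then show ?thesis
    proof cases
      case 2
      have "trib_word (Suc (sub_len (j + c))) = trib_word (Suc (sub_len (j' + c)))"
        unfolding trib_word_sub_len_Suc t ..
      then show ?thesis using 2 e by simp
    next
      case 3
      have "sub_len (Suc (j + c)) = sub_len j + x" "sub_len (Suc (j' + c)) = sub_len j' + x"
        using 3 e t by (simp_all add: sub_len_Suc)
      then show ?thesis by (metis trib_word_sub_len)
    qed (use IH in auto)
  qed
  then show ?case using d by simp
qed auto

lemma sub_len_pow_window_cong:
  assumes "\<forall>l<c. trib_word (j + l) = trib_word (j' + l)"
  shows "(sub_len ^^ m) (j + c) - (sub_len ^^ m) j = (sub_len ^^ m) (j' + c) - (sub_len ^^ m) j' \<and>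
    (\<forall>x<(sub_len ^^ m) (j + c) - (sub_len ^^ m) j.
       trib_word ((sub_len ^^ m) j + x) = trib_word ((sub_len ^^ m) j' + x))"
proof (induction m)
  case 0
  show ?case using assms by simp
next
  case (Suc m)
  have mono: "(sub_len ^^ m) a \<le> (sub_len ^^ m) (a + c)" for a
    by (induction m) auto
  obtain d where d: "(sub_len ^^ m) (j + c) = (sub_len ^^ m) j + d"
    using mono[of j] le_Suc_ex by blast
  then have d': "(sub_len ^^ m) (j' + c) = (sub_len ^^ m) j' + d"
    using Suc mono[of j'] by auto
  show ?case
    using sub_len_window_cong[of d "(sub_len ^^ m) j" "(sub_len ^^ m) j'"] Suc by (simp add: d d')
qed

text \<open>A letter is decided by the letter right after the start of its image: 1, 2 or 0 for the
  letters 0, 1, 2, the last being the start of the next block. So the window must reach one position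
  past a block start.\<close>

lemma desubst_window:
  assumes "\<forall>x<h. trib_word (sub_len j + x) = trib_word (sub_len j' + x)"
    and "Suc (sub_len (j + c) - sub_len j) < h"
  shows "\<forall>l\<le>c. trib_word (j + l) = trib_word (j' + l)"
  using assms(2)
proof (induction c)
  have letter: "trib_word (j + c) = trib_word (j' + c)"
    if "Suc (sub_len (j + c) - sub_len j) < h" "\<forall>l<c. trib_word (j + l) = trib_word (j' + l)" for c
  proof -
    let ?d = "sub_len (j + c) - sub_len j"
    have "?d = sub_len (j' + c) - sub_len j'"
      using sub_len_window_cong[OF that(2)] by simp
    then have e: "sub_len (j + c) = sub_len j + ?d" "sub_len (j' + c) = sub_len j' + ?d"
      using sub_len_mono[of j "j + c"] sub_len_mono[of j' "j' + c"] by linarith+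
    have "trib_word (sub_len j + Suc ?d) = trib_word (sub_len j' + Suc ?d)"
      using assms(1) that(1) by blast
    then have "trib_word (Suc (sub_len (j + c))) = trib_word (Suc (sub_len (j' + c)))"
      using e by simp
    then show ?thesis
      using trib_word_cases[of "j + c"] trib_word_cases[of "j' + c"]
      unfolding trib_word_sub_len_Suc by (elim disjE) simp_all
  qed
  {
    case 0
    then show ?case using letter[of 0] by simp
  next
    case (Suc c)
    have "sub_len (j + c) \<le> sub_len (j + Suc c)" by simp
    then have "Suc (sub_len (j + c) - sub_len j) < h" using Suc.prems by linarith
    then have "\<forall>l\<le>c. trib_word (j + l) = trib_word (j' + l)" by (rule Suc.IH)
    then show ?case using letter[of "Suc c"] Suc.prems by (auto simp: le_Suc_eq less_Suc_eq_le)
  }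
qed

subsection \<open>Special factors\<close>

text \<open>A nonzero letter is always preceded by 0, so a nonempty left special word starts with 0,
  at a block boundary. The images end in the distinct letters 1, 2, 0, hence the preceding letter
  determines the preceding block, and the preimage is a shorter left special word, to which
  induction applies.\<close>

lemma left_special_prefix:
  assumes "trib_word p \<noteq> trib_word q" and "\<forall>l<h. trib_word (Suc p + l) = trib_word (Suc q + l)"
  shows "\<forall>l<h. trib_word (Suc p + l) = trib_word l"
  using assms
proof (induction h arbitrary: p q rule: less_induct)
  case (less h)
  have t00: "trib_word 0 = 0" using trib_word_sub_len[of 0] by simp
  show ?case
  proof (cases "h = 0")
    case False
    have start: "trib_word (Suc p) = trib_word (Suc q)" using less.prems(2) False by force
    have prev: "trib_word p = 0" if "trib_word (Suc p) \<noteq> 0" for p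
    proof (cases "Suc p" rule: sub_len_cases)
      case (2 j)
      then show ?thesis by simp
    qed (use that in auto)
    have s0: "trib_word (Suc p) = 0" "trib_word (Suc q) = 0"
      using prev[of p] prev[of q] start less.prems(1) by metis+
    have pred: "\<exists>j. Suc p = sub_len (Suc j) \<and>
        trib_word p = (if trib_word j = 0 then 1 else if trib_word j = 1 then 2 else 0)"
      if p: "trib_word (Suc p) = 0" for p
    proof -
      obtain i where i: "Suc p = sub_len i" using p unfolding trib_word_eq_0_iff by blast
      obtain j where j: "i = Suc j" using i by (cases i) auto
      show ?thesis
        using i trib_word_cases[of j] unfolding j
        by (intro exI[of _ j]) (auto simp: sub_len_Suc trib_word_sub_len_Suc)
    qed
    obtain p' where p': "Suc p = sub_len (Suc p')"
      "trib_word p = (if trib_word p' = 0 then 1 else if trib_word p' = 1 then 2 else 0)"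
      using pred[OF s0(1)] by blast
    obtain q' where q': "Suc q = sub_len (Suc q')"
      "trib_word q = (if trib_word q' = 0 then 1 else if trib_word q' = 1 then 2 else 0)"
      using pred[OF s0(2)] by blast
    have ne: "trib_word p' \<noteq> trib_word q'" using less.prems(1) p'(2) q'(2) by metis
    show ?thesis
    proof (cases "h = 1")
      case True
      then show ?thesis using s0 t00 by simp
    next
      case h1: False
      \<comment> \<open>\<open>f c\<close> is the offset that decides the c-th letter of the
        preimage. Taking the last c with \<open>f c < h\<close>, the images of the c + 1 recovered
        letters, together with the 0 that follows them, cover the window.\<close>
      define f where "f c = Suc (sub_len (Suc p' + c) - sub_len (Suc p'))" for c
      have fc: "c < f c" for c
      proof (induction c)
        case (Suc c)
        have "sub_len (Suc p' + c) < sub_len (Suc p' + Suc c)" "sub_len (Suc p') \<le> sub_len (Suc p' + c)"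
          by simp_all
        then show ?case using Suc unfolding f_def by linarith
      qed (simp add: f_def)
      have f0: "f 0 < h" using h1 False by (simp add: f_def)
      have "\<not> f h < h" using fc[of h] by simp
      then obtain c where c: "f c < h" "\<not> f (Suc c) < h"
        using f0 ex_least_nat_less[of "\<lambda>c. \<not> f c < h" h] by auto
      have "\<forall>l\<le>c. trib_word (Suc p' + l) = trib_word (Suc q' + l)"
        by (rule desubst_window[of h]) (use less.prems(2) p' q' c(1) in \<open>auto simp: f_def\<close>)
      then have "\<forall>l<Suc c. trib_word (Suc p' + l) = trib_word (Suc q' + l)" by simp
      then have "\<forall>l<Suc c. trib_word (Suc p' + l) = trib_word l"
        using less.IH[of "Suc c" p' q'] ne c(1) fc[of c] by simp
      then have "\<forall>l<Suc c. trib_word (Suc p' + l) = trib_word (0 + l)" by simp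
      from sub_len_window_cong[OF this]
      have "trib_word (sub_len (Suc p') + x) = trib_word x" if "x \<le> sub_len (Suc p' + Suc c) - sub_len (Suc p')" for x
        using that by auto
      then show ?thesis using c(2) p'(1) unfolding f_def by simp
    qed
  qed simp
qed

definition right_special :: "nat list \<Rightarrow> bool" where
  "right_special y \<longleftrightarrow> (\<exists>i j. window i (length y) = y \<and> window j (length y) = y \<and>
     trib_word (i + length y) \<noteq> trib_word (j + length y))"

text \<open>Deleting the first letter is injective except on the left extensions of the prefix of
  length h, of which there are at most three.\<close>

lemma card_windows_Suc_le: "card (range (\<lambda>i. window i (Suc h))) \<le> card (range (\<lambda>i. window i h)) + 2"
proof -
  let ?F = "\<lambda>h. range (\<lambda>i. window i h)"
  define A where "A = {w \<in> ?F (Suc h). tl w = window 0 h}"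
  define A' where "A' = {w \<in> ?F (Suc h). tl w \<noteq> window 0 h}"
  have U: "?F (Suc h) = A \<union> A'" by (auto simp: A_def A'_def)
  have "A \<subseteq> (\<lambda>a. a # window 0 h) ` {0, 1, 2}"
    using trib_word_mem by (auto simp: A_def window_Suc simp del: insert_iff image_insert)
  then have "card A \<le> card ((\<lambda>a. a # window 0 h) ` {0, 1, 2 :: nat})" by (intro card_mono) auto
  also have "\<dots> \<le> card {0, 1, 2 :: nat}" by (rule card_image_le) simp
  finally have A3: "card A \<le> 3" by simp
  have inj: "inj_on tl A'"
  proof (rule inj_onI)
    fix v w assume v: "v \<in> A'" and w: "w \<in> A'" and eq: "tl v = tl w"
    obtain p q where pq: "v = window p (Suc h)" "w = window q (Suc h)" using v w by (auto simp: A'_def)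
    have e: "window (Suc p) h = window (Suc q) h" using eq pq by (simp add: window_Suc)
    have ne: "window (Suc p) h \<noteq> window 0 h" using v pq by (simp add: A'_def window_Suc)
    have "trib_word p = trib_word q"
    proof (rule ccontr)
      assume "trib_word p \<noteq> trib_word q"
      then have "\<forall>l<h. trib_word (Suc p + l) = trib_word l"
        using left_special_prefix e by (metis window_eq_iff)
      then show False using ne by (simp add: window_eq_iff)
    qed
    then show "v = w" using pq e by (simp add: window_Suc)
  qed
  have "tl ` A' \<subseteq> ?F h - {window 0 h}" by (auto simp: A'_def window_Suc)
  then have "card (tl ` A') \<le> card (?F h - {window 0 h})" by (intro card_mono) (auto simp: finite_windows)
  also have "\<dots> = card (?F h) - 1" by (subst card_Diff_singleton) auto
  finally have "card A' \<le> card (?F h) - 1" using card_image[OF inj] by simp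
  moreover have "card (?F h) > 0" by (subst card_gt_0_iff) (auto simp: finite_windows)
  moreover have "card (?F (Suc h)) \<le> card A + card A'" unfolding U by (rule card_Un_le)
  ultimately show ?thesis using A3 by linarith
qed

text \<open>Right special words are counted instead of desubstituted: every word of length h has
  some right extension \<open>e y\<close>, a right special one has a second \<open>g y\<close>, and
  the number of words grows by at most 2.\<close>

lemma right_special_card:
  "finite {y. length y = h \<and> right_special y}" "card {y. length y = h \<and> right_special y} \<le> 2"
proof -
  let ?F = "\<lambda>h. range (\<lambda>i. window i h)"
  let ?R = "{y. length y = h \<and> right_special y}"
  have R: "?R \<subseteq> ?F h" by (auto simp: right_special_def) (metis rangeI)
  then show fin: "finite ?R" using finite_windows finite_subset by blast
  define e where "e y = y @ [trib_word ((SOME i. window i h = y) + h)]" for y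
  have e: "e y \<in> ?F (Suc h)" if "y \<in> ?F h" for y
  proof -
    have "\<exists>i. window i h = y" using that by auto
    then have "window (SOME i. window i h = y) h = y" by (rule someI_ex)
    then have "e y = window (SOME i. window i h = y) (Suc h)" unfolding e_def by (simp add: window_snoc)
    then show ?thesis by simp
  qed
  have "\<exists>z. z \<in> ?F (Suc h) \<and> z \<noteq> e y \<and> butlast z = y" if "y \<in> ?R" for y
  proof -
    obtain i j where ij: "window i h = y" "window j h = y" "trib_word (i + h) \<noteq> trib_word (j + h)"
      using \<open>y \<in> ?R\<close> by (auto simp: right_special_def)
    have "window i (Suc h) \<noteq> e y \<or> window j (Suc h) \<noteq> e y"
      using ij by (auto simp: e_def window_snoc)
    moreover have "butlast (window i (Suc h)) = y" "butlast (window j (Suc h)) = y"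
      using ij by (simp_all add: window_snoc)
    ultimately show ?thesis by blast
  qed
  then obtain g where g: "\<And>y. y \<in> ?R \<Longrightarrow> g y \<in> ?F (Suc h) \<and> g y \<noteq> e y \<and> butlast (g y) = y"
    by metis
  have bl: "butlast (e y) = y" for y by (simp add: e_def)
  have "inj_on e (?F h)" by (metis bl inj_onI)
  moreover have "inj_on g ?R" by (metis (no_types, lifting) g inj_onI)
  moreover have "e ` ?F h \<inter> g ` ?R = {}"
  proof -
    have False if "y \<in> ?R" "e x = g y" for x y
      using g[OF that(1)] bl[of x] that(2) by metis
    then show ?thesis by blast
  qed
  ultimately have "card (e ` ?F h \<union> g ` ?R) = card (?F h) + card ?R"
    by (subst card_Un_disjoint) (simp_all only: fin finite_windows finite_imageI card_image)
  moreover have "card (e ` ?F h \<union> g ` ?R) \<le> card (?F (Suc h))"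
    by (intro card_mono finite_windows) (use e g in blast)
  ultimately show "card ?R \<le> 2" using card_windows_Suc_le[of h] by linarith
qed

subsection \<open>The Pisot property\<close>

lemma trib_root_exists: "\<exists>\<beta>::real. 9 / 5 \<le> \<beta> \<and> \<beta> \<le> 19 / 10 \<and> \<beta> ^ 3 = \<beta>\<^sup>2 + \<beta> + 1"
proof -
  have "\<exists>x::real. 9 / 5 \<le> x \<and> x \<le> 19 / 10 \<and> x ^ 3 - x\<^sup>2 - x = 1"
    by (rule IVT) (auto simp: power2_eq_square power3_eq_cube intro!: continuous_intros)
  then show ?thesis by (auto simp: algebra_simps)
qed

definition trib_root :: real where
  "trib_root = (SOME \<beta>. 9 / 5 \<le> \<beta> \<and> \<beta> \<le> 19 / 10 \<and> \<beta> ^ 3 = \<beta>\<^sup>2 + \<beta> + 1)"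

lemma trib_root:
  shows trib_root_ge: "9 / 5 \<le> trib_root" and trib_root_le: "trib_root \<le> 19 / 10"
    and trib_root_eq: "trib_root ^ 3 = trib_root\<^sup>2 + trib_root + 1"
  using someI_ex[OF trib_root_exists] unfolding trib_root_def by blast+

lemma trib_num_rec: "trib_num (i + 3) = trib_num (i + 2) + trib_num (i + 1) + trib_num i"
  by (simp add: eval_nat_numeral)

definition trib_defect :: "nat \<Rightarrow> real" where
  "trib_defect i = real (trib_num (i + 1)) - trib_root * real (trib_num i)"

text \<open>The defects satisfy the recurrence of the two complex conjugates of the root, whose
  modulus is below 3/4. The quadratic form in the proof is the squared modulus of the conjugate
  coordinate; it is multiplied by the inverse of the root in each step.\<close>
lemma trib_defect_bound: "\<exists>C\<ge>0. \<forall>i. \<bar>trib_defect i\<bar> \<le> C * (3 / 4) ^ i"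
proof -
  define b where "b = trib_root"
  \<comment> \<open>\<open>x\<^sup>2 + p x + r\<close> is the cofactor of \<open>x - b\<close> in
    \<open>x\<^sup>3 - x\<^sup>2 - x - 1\<close>, so its roots are the two conjugates.\<close>
  define p where "p = b - 1"
  define r where "r = b\<^sup>2 - b - 1"
  have b: "9 / 5 \<le> b" "b \<le> 19 / 10" "b ^ 3 = b\<^sup>2 + b + 1" using trib_root by (simp_all add: b_def)
  have rb: "r * b = 1" using b(3) by (simp add: r_def algebra_simps power2_eq_square power3_eq_cube)
  have r: "0 < r" "r \<le> 5 / 9" "10 / 19 \<le> r"
  proof -
    have e: "r = 1 / b" using rb b by (subst eq_divide_eq) auto
    show "0 < r" "r \<le> 5 / 9" "10 / 19 \<le> r" unfolding e using b by (auto simp: field_simps)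
  qed
  have p: "p\<^sup>2 \<le> (9 / 10)\<^sup>2" unfolding p_def by (rule power_mono) (use b in auto)
  have rec: "trib_defect (i + 2) = - p * trib_defect (i + 1) - r * trib_defect i" for i
  proof -
    have e: "real (trib_num (i + 3)) = real (trib_num (i + 2)) + real (trib_num (i + 1)) + real (trib_num i)"
      by (simp only: trib_num_rec of_nat_add)
    have "trib_defect (i + 2) + p * trib_defect (i + 1) + r * trib_defect i =
        real (trib_num (i + 3)) - real (trib_num (i + 2)) - real (trib_num (i + 1)) - (r * b) * real (trib_num i)"
      by (simp add: trib_defect_def p_def r_def b_def[symmetric] algebra_simps power2_eq_square eval_nat_numeral)
    then show ?thesis using rb e by simp
  qed
  define q where "q i = (trib_defect (i + 1))\<^sup>2 + p * trib_defect (i + 1) * trib_defect i + r * (trib_defect i)\<^sup>2" for i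
  have "q (Suc i) = r * q i" for i
  proof -
    have "(- p * y - r * x)\<^sup>2 + p * (- p * y - r * x) * y + r * y\<^sup>2 = r * (y\<^sup>2 + p * y * x + r * x\<^sup>2)" for x y
      by (simp add: power2_eq_square algebra_simps)
    from this[of "trib_defect (i + 1)" "trib_defect i"] show ?thesis
      using rec[of i] unfolding q_def by simp
  qed
  then have qi: "q i = r ^ i * q 0" for i by (induction i) auto
  \<comment> \<open>Completing the square; 3/10 lies below 10/19 - 81/400, a lower bound of
    \<open>r - p\<^sup>2 / 4\<close>.\<close>
  have q_ge: "(3 / 10) * (trib_defect i)\<^sup>2 \<le> q i" for i
  proof -
    have "q i = (trib_defect (i + 1) + p / 2 * trib_defect i)\<^sup>2 + (r - p\<^sup>2 / 4) * (trib_defect i)\<^sup>2"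
      by (simp add: q_def power2_eq_square algebra_simps)
    moreover have "3 / 10 * (trib_defect i)\<^sup>2 \<le> (r - p\<^sup>2 / 4) * (trib_defect i)\<^sup>2"
      by (rule mult_right_mono) (use p r in \<open>auto simp: power2_eq_square\<close>)
    ultimately show ?thesis by (smt (verit) zero_le_power2)
  qed
  have q0: "0 \<le> q 0" using q_ge[of 0] zero_le_power2[of "trib_defect 0"] by linarith
  \<comment> \<open>Adding 1 ensures C \<le> C * C, so that C can stand in for a square root
    below.\<close>
  define C where "C = 10 / 3 * q 0 + 1"
  have C1: "1 \<le> C" using q0 by (simp add: C_def)
  have "\<bar>trib_defect i\<bar> \<le> C * (3 / 4) ^ i" for i
  proof -
    have "(trib_defect i)\<^sup>2 \<le> 10 / 3 * q 0 * r ^ i" using q_ge[of i] qi[of i] by (simp add: algebra_simps)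
    \<comment> \<open>The rate 3/4 comes from r \<le> 5/9 < 9/16.\<close>
    also have "\<dots> \<le> 10 / 3 * q 0 * (9 / 16) ^ i"
      by (intro mult_left_mono power_mono) (use q0 r in auto)
    also have "\<dots> \<le> C * C * (9 / 16) ^ i"
    proof (rule mult_right_mono)
      have "C * 1 \<le> C * C" using C1 by (intro mult_left_mono) auto
      moreover have "10 / 3 * q 0 \<le> C" by (simp add: C_def)
      ultimately show "10 / 3 * q 0 \<le> C * C" by linarith
    qed simp
    also have "\<dots> = (C * (3 / 4) ^ i)\<^sup>2"
      by (simp add: power2_eq_square algebra_simps flip: power_mult_distrib)
    finally show ?thesis
      using C1 by (subst (asm) abs_le_square_iff[symmetric]) auto
  qed
  then show ?thesis using C1 by (intro exI[of _ C]) auto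
qed

lemma trib_defect_sum_bound: "\<exists>C\<ge>0. \<forall>n. (\<Sum>i<n. \<bar>trib_defect i\<bar>) \<le> C"
proof -
  obtain C where C: "C \<ge> 0" "\<And>i. \<bar>trib_defect i\<bar> \<le> C * (3 / 4) ^ i"
    using trib_defect_bound by blast
  have "(\<Sum>i<n. \<bar>trib_defect i\<bar>) \<le> 4 * C" for n
  proof -
    have "(\<Sum>i<n. \<bar>trib_defect i\<bar>) \<le> 4 * C * (1 - (3 / 4) ^ n)"
    proof (induction n)
      case (Suc n)
      then show ?case using C(2)[of n] by (simp add: algebra_simps)
    qed simp
    also have "\<dots> \<le> 4 * C" using C(1) by (simp add: mult_left_le)
    finally show ?thesis .
  qed
  then show ?thesis using C(1) by (intro exI[of _ "4 * C"]) auto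
qed

text \<open>For a binary representation of n the error is the sum of the defects at the places with
  digit 1, and the defects are absolutely summable.\<close>

lemma sub_len_approx: "\<exists>C\<ge>0. \<forall>n. \<bar>real (sub_len n) - trib_root * real n\<bar> \<le> C"
proof -
  obtain C where C: "C \<ge> 0" "\<And>n. (\<Sum>i<n. \<bar>trib_defect i\<bar>) \<le> C"
    using trib_defect_sum_bound by blast
  have "\<bar>real (sub_len n) - trib_root * real n\<bar> \<le> C" for n
  proof -
    obtain u where u: "set u \<subseteq> {0, 1}" "trib_val u = n" using trib_val_surj by blast
    have "\<bar>real (trib_val (u @ [0])) - trib_root * real (trib_val u)\<bar> \<le> (\<Sum>i<length u. \<bar>trib_defect i\<bar>)"
      using u(1)
    proof (induction u)
      case (Cons d u)
      have "\<bar>real d * trib_defect (length u)\<bar> \<le> \<bar>trib_defect (length u)\<bar>" using Cons.prems by auto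
      moreover have "real (trib_val ((d # u) @ [0])) - trib_root * real (trib_val (d # u)) =
          real d * trib_defect (length u) + (real (trib_val (u @ [0])) - trib_root * real (trib_val u))"
        by (simp add: trib_defect_def algebra_simps)
      ultimately show ?case using Cons by simp
    qed simp
    then show ?thesis using sub_len_trib_val[OF u(1)] u(2) C(2)[of "length u"] by simp
  qed
  then show ?thesis using C(1) by blast
qed

text \<open>Counting zeros inverts \<open>sub_len\<close> up to 1, which gives frequency g =
  1/\<beta>. The ones before n are the zeros before its block index, which gives g * g; the twos
  make up the rest.\<close>

lemma letter_count_approx:
  "\<exists>C\<ge>0. \<exists>f. \<forall>a\<le>2. \<forall>n. \<bar>real (letter_count a n) - f a * real n\<bar> \<le> C"
proof -
  obtain C where C: "C \<ge> 0" "\<And>n. \<bar>real (sub_len n) - trib_root * real n\<bar> \<le> C"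
    using sub_len_approx by blast
  define g where "g = inverse trib_root"
  have g: "0 < g" "g \<le> 1" "g * trib_root = 1"
    using trib_root_ge by (auto simp: g_def field_simps)
  have shrink: "\<bar>g * x\<bar> \<le> \<bar>x\<bar>" for x
    using g by (simp add: abs_mult mult_left_le_one_le)
  have key: "\<exists>j. \<bar>real j - g * real n\<bar> \<le> C + 1 \<and> (letter_count 0 n = j \<or> letter_count 0 n = Suc j)
      \<and> letter_count 1 n = letter_count 0 j" for n
  proof -
    have *: "\<bar>real j - g * real n\<bar> \<le> C + 1" if "n = sub_len j \<or> n = Suc (sub_len j)" for j
    proof -
      have "real j - g * real n = g * (trib_root * real j - real n)" using g by (simp add: algebra_simps)
      also have "\<bar>\<dots>\<bar> \<le> \<bar>trib_root * real j - real n\<bar>" by (rule shrink)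
      also have "\<dots> \<le> C + 1" using C(2)[of j] that by auto
      finally show ?thesis .
    qed
    show ?thesis
    proof (cases n rule: sub_len_cases)
      case (1 j)
      then show ?thesis using *[of j] letter_count_sub_len by blast
    next
      case (2 j)
      then show ?thesis using *[of j]
        by (intro exI[of _ j])
          (auto simp: letter_count_sub_len letter_count_sub_len(2)[unfolded One_nat_def] letter_count_Suc)
    qed
  qed
  have 0: "\<bar>real (letter_count 0 n) - g * real n\<bar> \<le> C + 2" for n
    using key[of n] by auto
  have 1: "\<bar>real (letter_count 1 n) - g * g * real n\<bar> \<le> 2 * C + 3" for n
  proof -
    obtain j where j: "\<bar>real j - g * real n\<bar> \<le> C + 1" "letter_count 1 n = letter_count 0 j"
      using key[of n] by blast
    have "\<bar>g * (real j - g * real n)\<bar> \<le> C + 1" using shrink j(1) order_trans by blast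
    then have "\<bar>g * real j - g * g * real n\<bar> \<le> C + 1" by (simp add: algebra_simps)
    then show ?thesis using 0[of j] j(2) by linarith
  qed
  have 2: "\<bar>real (letter_count 2 n) - (1 - g - g * g) * real n\<bar> \<le> 3 * C + 5" for n
  proof -
    have "real (letter_count 0 n) + real (letter_count 1 n) + real (letter_count 2 n) = real n"
      by (simp only: letter_count_sum flip: of_nat_add)
    moreover have "(1 - g - g * g) * real n = real n - g * real n - g * g * real n"
      by (simp add: algebra_simps)
    ultimately show ?thesis using 0[of n] 1[of n] by linarith
  qed
  define f where "f a = (if a = 0 then g else if a = 1 then g * g else 1 - g - g * g)" for a :: nat
  have "\<bar>real (letter_count a n) - f a * real n\<bar> \<le> 3 * C + 5" if "a \<le> 2" for a n
  proof -
    have "a = 0 \<or> a = 1 \<or> a = 2" using that by auto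
    then show ?thesis using 0[of n] 1[of n] 2[of n] C(1) by (auto simp: f_def)
  qed
  then show ?thesis using C(1) by (intro exI[of _ "3 * C + 5"]) auto
qed

subsection \<open>Regular languages by finitely many residuals\<close>

text \<open>Left quotients replace automata, so the alphabet may be infinite. This permits letters
  of type \<open>nat \<Rightarrow> bool\<close>, which carry digits for all variables at once and
  spare the bookkeeping of arities.\<close>

definition regular_lang :: "'c list set \<Rightarrow> bool" where
  "regular_lang L \<longleftrightarrow> finite (range (\<lambda>w. {v. w @ v \<in> L}))"

lemma regular_lang_Compl:
  assumes "regular_lang L" shows "regular_lang (- L)"
proof -
  have "(\<lambda>w. {v. w @ v \<in> - L}) = (\<lambda>w. - {v. w @ v \<in> L})" by auto
  then have "range (\<lambda>w. {v. w @ v \<in> - L}) = uminus ` range (\<lambda>w. {v. w @ v \<in> L})" by auto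
  then show ?thesis using assms by (simp add: regular_lang_def)
qed

lemma regular_lang_Int:
  assumes "regular_lang L" "regular_lang L'" shows "regular_lang (L \<inter> L')"
proof -
  have "range (\<lambda>w. {v. w @ v \<in> L \<inter> L'}) \<subseteq>
      (\<lambda>(R, R'). R \<inter> R') ` (range (\<lambda>w. {v. w @ v \<in> L}) \<times> range (\<lambda>w. {v. w @ v \<in> L'}))"
    by auto
  then show ?thesis using assms unfolding regular_lang_def by (meson finite_SigmaI finite_imageI finite_subset)
qed

lemma regular_lang_vimage_map:
  assumes "regular_lang L" shows "regular_lang {w. map h w \<in> L}"
proof -
  have "range (\<lambda>w. {v. w @ v \<in> {w. map h w \<in> L}}) \<subseteq>
      (\<lambda>R. {v. map h v \<in> R}) ` range (\<lambda>w. {v. w @ v \<in> L})"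
    by auto
  then show ?thesis using assms unfolding regular_lang_def by (meson finite_imageI finite_subset)
qed

text \<open>Projection of a track, the projected words being stripped of leading copies of the
  letter z: a witness may need more digits than the projected word has.\<close>
lemma regular_lang_project:
  assumes "regular_lang L"
  shows "regular_lang {w. \<exists>m w'. map h w' = replicate m z @ w \<and> w' \<in> L}"
    (is "regular_lang ?P")
proof -
  let ?Res = "range (\<lambda>w. {v. w @ v \<in> L})"
  have "{v. w @ v \<in> ?P} \<in> (\<lambda>G. \<Union>R\<in>G. map h ` R) ` Pow ?Res" for w
  proof
    define G where "G = (\<lambda>w1. {v. w1 @ v \<in> L}) ` {w1. \<exists>m. map h w1 = replicate m z @ w}"
    show "G \<in> Pow ?Res" by (auto simp: G_def)
    show "{v. w @ v \<in> ?P} = (\<Union>R\<in>G. map h ` R)"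
    proof (intro equalityI subsetI)
      fix v assume "v \<in> {v. w @ v \<in> ?P}"
      then obtain m w' where w': "map h w' = replicate m z @ w @ v" "w' \<in> L" by auto
      then obtain w1 v1 where "w' = w1 @ v1" "map h w1 = replicate m z @ w" "map h v1 = v"
        by (metis append.assoc map_eq_append_conv)
      then show "v \<in> (\<Union>R\<in>G. map h ` R)" using w'(2) by (auto simp: G_def)
    next
      fix v assume "v \<in> (\<Union>R\<in>G. map h ` R)"
      then obtain w1 m v1 where 1: "map h w1 = replicate m z @ w" "w1 @ v1 \<in> L" "v = map h v1"
        by (auto simp: G_def)
      then have "map h (w1 @ v1) = replicate m z @ w @ v" by simp
      then show "v \<in> {v. w @ v \<in> ?P}" using 1(2) by blast
    qed
  qed
  then have "range (\<lambda>w. {v. w @ v \<in> ?P}) \<subseteq> (\<lambda>G. \<Union>R\<in>G. map h ` R) ` Pow ?Res" by blast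
  then show ?thesis using assms unfolding regular_lang_def
    by (meson finite_Pow_iff finite_imageI finite_subset)
qed

subsection \<open>Linear relations between representations\<close>

text \<open>The parameter n stands for n zeros appended to the word, so the values for all n
  describe the state that the word reaches. The coefficient at the next higher place makes shifted
  digits expressible.\<close>

fun lin_val :: "('c \<Rightarrow> int) \<Rightarrow> ('c \<Rightarrow> int) \<Rightarrow> nat \<Rightarrow> 'c list \<Rightarrow> int" where
  "lin_val a b n [] = 0"
| "lin_val a b n (c # w) = a c * int (trib_num (n + length w)) + b c * int (trib_num (n + length w + 1))
     + lin_val a b n w"

lemma lin_val_append: "lin_val a b n (w @ v) = lin_val a b (n + length v) w + lin_val a b n v"
  by (induction w) (auto simp: algebra_simps)

lemma lin_val_rec: "lin_val a b (n + 3) w = lin_val a b (n + 2) w + lin_val a b (n + 1) w + lin_val a b n w"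
proof (induction w)
  case (Cons c w)
  have "trib_num (n + 3 + length w) = trib_num (n + 2 + length w) + trib_num (n + 1 + length w) + trib_num (n + length w)"
    "trib_num (n + 3 + length w + 1) = trib_num (n + 2 + length w + 1) + trib_num (n + 1 + length w + 1) + trib_num (n + length w + 1)"
    by (simp_all add: eval_nat_numeral)
  then show ?case using Cons by (simp only: lin_val.simps of_nat_add algebra_simps)
qed simp

lemma lin_val_state:
  assumes "\<forall>n<3. lin_val a b n w = lin_val a b n w'"
  shows "lin_val a b n w = lin_val a b n w'"
proof (induction n rule: less_induct)
  case (less n)
  show ?case
  proof (cases "n < 3")
    case False
    then obtain m where "n = m + 3" by (metis add.commute le_Suc_ex not_less)
    then show ?thesis using less by (simp add: lin_val_rec)
  qed (use assms in blast)
qed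

lemma trib_num_le_power: "real (trib_num n) \<le> 2 * trib_root ^ n"
proof (induction n rule: less_induct)
  case (less n)
  have b: "9 / 5 \<le> trib_root" by (rule trib_root_ge)
  have b2: "(9 / 5)\<^sup>2 \<le> trib_root\<^sup>2" by (rule power_mono) (use b in auto)
  consider "n = 0" | "n = 1" | "n = 2" | m where "n = m + 3"
  proof -
    have "n = 0 \<or> n = 1 \<or> n = 2 \<or> n = (n - 3) + 3" by auto
    then show ?thesis using that by metis
  qed
  then show ?case
  proof cases
    case 3
    then show ?thesis using b2 by (simp add: eval_nat_numeral)
  next
    case (4 m)
    have "real (trib_num n) = real (trib_num (m + 2)) + real (trib_num (m + 1)) + real (trib_num m)"
      by (simp only: 4 trib_num_rec of_nat_add)
    also have "\<dots> \<le> 2 * trib_root ^ (m + 2) + 2 * trib_root ^ (m + 1) + 2 * trib_root ^ m"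
      using less[of "m + 2"] less[of "m + 1"] less[of m] 4 by simp
    also have "\<dots> = 2 * trib_root ^ m * (trib_root\<^sup>2 + trib_root + 1)"
      by (simp add: algebra_simps power_add power2_eq_square)
    also have "\<dots> = 2 * trib_root ^ n" by (simp only: 4 power_add mult.assoc trib_root_eq)
    finally show ?thesis .
  qed (use b in auto)
qed

text \<open>The values at 0, 1, 2 form the state of an automaton reading the word. If some continuation
  brings the value to 0, the dominant coordinate of the state is bounded because it has to be
  compensated by the continuation; the contracting coordinates are always bounded.\<close>
lemma lin_val_bounded:
  fixes a b :: "'c \<Rightarrow> int"
  assumes B: "\<And>c. \<bar>a c\<bar> \<le> B" "\<And>c. \<bar>b c\<bar> \<le> B"
  shows "\<exists>K. \<forall>w v. lin_val a b 0 (w @ v) = 0 \<longrightarrow> (\<forall>n<3. \<bar>lin_val a b n w\<bar> \<le> K)"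
proof -
  obtain C where C: "C \<ge> 0" "\<And>n. (\<Sum>i<n. \<bar>trib_defect i\<bar>) \<le> C"
    using trib_defect_sum_bound by blast
  let ?\<beta> = trib_root
  have \<beta>: "9 / 5 \<le> ?\<beta>" "?\<beta> \<le> 19 / 10" by (rule trib_root_ge, rule trib_root_le)
  have B0: "0 \<le> B" using B(1) abs_ge_zero order_trans by blast
  \<comment> \<open>The state with its dominant part removed: a sum of bounded digits times defects,
    hence bounded for every word.\<close>
  define E where "E n w = real_of_int (lin_val a b (Suc n) w) - ?\<beta> * real_of_int (lin_val a b n w)" for n w
  define C1 where "C1 = 2 * real_of_int B * C"
  have C1: "0 \<le> C1" using B0 C(1) by (simp add: C1_def)
  have aB: "\<bar>real_of_int (a c) * x\<bar> \<le> real_of_int B * \<bar>x\<bar>" "\<bar>real_of_int (b c) * x\<bar> \<le> real_of_int B * \<bar>x\<bar>" for c x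
    using B by (auto simp: abs_mult intro!: mult_right_mono simp flip: of_int_abs)
  have E: "\<bar>E n w\<bar> \<le> C1" for n w
  proof -
    have "\<bar>E n w\<bar> \<le> real_of_int B * (\<Sum>i<length w. \<bar>trib_defect (n + i)\<bar> + \<bar>trib_defect (Suc n + i)\<bar>)"
    proof (induction w)
      case (Cons c w)
      have "E n (c # w) = real_of_int (a c) * trib_defect (n + length w)
          + real_of_int (b c) * trib_defect (Suc n + length w) + E n w"
        by (simp add: E_def trib_defect_def algebra_simps)
      then show ?case using Cons aB(1)[of c "trib_defect (n + length w)"] aB(2)[of c "trib_defect (Suc n + length w)"]
        by (simp add: algebra_simps)
    qed (simp add: E_def)
    also have "(\<Sum>i<length w. \<bar>trib_defect (n + i)\<bar> + \<bar>trib_defect (Suc n + i)\<bar>) \<le> C + C"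
    proof -
      have "(\<Sum>i<l. \<bar>trib_defect (m + i)\<bar>) \<le> C" for m l
      proof -
        have "(\<Sum>i<l. \<bar>trib_defect (m + i)\<bar>) = (\<Sum>i\<in>(+) m ` {..<l}. \<bar>trib_defect i\<bar>)"
          by (simp add: sum.reindex)
        also have "\<dots> \<le> (\<Sum>i<m + l. \<bar>trib_defect i\<bar>)" by (rule sum_mono2) auto
        also have "\<dots> \<le> C" by (rule C(2))
        finally show ?thesis .
      qed
      then show ?thesis unfolding sum.distrib by (intro add_mono)
    qed
    finally have "\<bar>E n w\<bar> \<le> real_of_int B * (C + C)" using B0 by (simp add: mult_left_mono)
    then show ?thesis by (simp add: C1_def algebra_simps)
  qed
  \<comment> \<open>A digit contributes at most 2 B at its own place and 2 B \<beta> at the next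
    one, relative to the power of \<beta>; the induction closes because 14 + 2 \<beta> \<le> 12
    \<beta>.\<close>
  define K0 where "K0 = 12 * real_of_int B"
  have tail: "\<bar>real_of_int (lin_val a b 0 v)\<bar> \<le> K0 * ?\<beta> ^ length v" for v
  proof (induction v)
    case (Cons c v)
    let ?n = "length v"
    have "\<bar>real_of_int (a c) * real (trib_num ?n)\<bar> \<le> real_of_int B * (2 * ?\<beta> ^ ?n)"
      using aB(1)[of c "real (trib_num ?n)"] trib_num_le_power[of ?n] B0
      by (smt (verit) mult_left_mono of_int_0_le_iff of_nat_0_le_iff)
    moreover have "\<bar>real_of_int (b c) * real (trib_num (Suc ?n))\<bar> \<le> real_of_int B * (2 * ?\<beta> ^ Suc ?n)"
      using aB(2)[of c "real (trib_num (Suc ?n))"] trib_num_le_power[of "Suc ?n"] B0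
      by (smt (verit) mult_left_mono of_int_0_le_iff of_nat_0_le_iff)
    moreover have "real_of_int (lin_val a b 0 (c # v)) = real_of_int (a c) * real (trib_num ?n)
        + real_of_int (b c) * real (trib_num (Suc ?n)) + real_of_int (lin_val a b 0 v)"
      by simp
    ultimately have "\<bar>real_of_int (lin_val a b 0 (c # v))\<bar> \<le>
        real_of_int B * (2 * ?\<beta> ^ ?n) + real_of_int B * (2 * ?\<beta> ^ Suc ?n) + K0 * ?\<beta> ^ ?n"
      using Cons by linarith
    also have "\<dots> = (real_of_int B * ?\<beta> ^ ?n) * (14 + 2 * ?\<beta>)"
      by (simp add: K0_def algebra_simps)
    also have "\<dots> \<le> (real_of_int B * ?\<beta> ^ ?n) * (12 * ?\<beta>)"
      by (rule mult_left_mono) (use \<beta> B0 in auto)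
    finally show ?case by (simp add: K0_def algebra_simps)
  qed (simp add: K0_def B0)
  define K1 where "K1 = K0 + 2 * C1"
  \<comment> \<open>Errors of C1 per step sum up to at most C1 / (\<beta> - 1), relative to the
    power of \<beta>, and 1 / (\<beta> - 1) \<le> 2. A start value beyond that keeps growing like
    the powers of \<beta>.\<close>
  have head: "\<bar>x 0\<bar> * ?\<beta> ^ n \<le> \<bar>x n\<bar> + 2 * C1 * (?\<beta> ^ n - 1)"
    if "\<And>i. \<bar>x (Suc i) - ?\<beta> * x i\<bar> \<le> C1" for x :: "nat \<Rightarrow> real" and n
  proof (induction n)
    case (Suc n)
    have "\<bar>x 0\<bar> * ?\<beta> ^ Suc n = ?\<beta> * (\<bar>x 0\<bar> * ?\<beta> ^ n)" by simp
    also have "\<dots> \<le> ?\<beta> * (\<bar>x n\<bar> + 2 * C1 * (?\<beta> ^ n - 1))" using Suc \<beta> by (intro mult_left_mono) auto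
    also have "\<dots> = \<bar>?\<beta> * x n\<bar> + 2 * C1 * (?\<beta> ^ Suc n - ?\<beta>)" using \<beta> by (simp add: abs_mult algebra_simps)
    also have "\<dots> \<le> \<bar>x (Suc n)\<bar> + C1 + 2 * C1 * (?\<beta> ^ Suc n - ?\<beta>)" using that[of n] by linarith
    also have "\<dots> \<le> \<bar>x (Suc n)\<bar> + 2 * C1 * (?\<beta> ^ Suc n - 1)"
    proof -
      have "C1 * (1 - 2 * ?\<beta> + 2) \<le> 0" using C1 \<beta> by (intro mult_nonneg_nonpos) auto
      then show ?thesis by (simp add: algebra_simps)
    qed
    finally show ?case .
  qed simp
  have "\<bar>lin_val a b n w\<bar> \<le> \<lceil>4 * K1 + 4 * C1\<rceil>" if z: "lin_val a b 0 (w @ v) = 0" and n: "n < 3" for w v n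
  proof -
    let ?x = "\<lambda>i. real_of_int (lin_val a b i w)"
    let ?n = "length v"
    have bpos: "0 < ?\<beta> ^ ?n" using \<beta> by simp
    have "lin_val a b ?n w = - lin_val a b 0 v" using z by (simp add: lin_val_append)
    then have "\<bar>?x ?n\<bar> \<le> K0 * ?\<beta> ^ ?n" using tail[of v] by simp
    moreover have "\<bar>?x 0\<bar> * ?\<beta> ^ ?n \<le> \<bar>?x ?n\<bar> + 2 * C1 * (?\<beta> ^ ?n - 1)"
      by (rule head) (use E in \<open>simp add: E_def\<close>)
    ultimately have "\<bar>?x 0\<bar> * ?\<beta> ^ ?n \<le> K1 * ?\<beta> ^ ?n" using C1 by (simp add: K1_def algebra_simps)
    then have x0: "\<bar>?x 0\<bar> \<le> K1" using bpos by simp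
    have s: "\<bar>?x (Suc i)\<bar> \<le> 2 * \<bar>?x i\<bar> + C1" for i
    proof -
      have "\<bar>?\<beta> * ?x i\<bar> \<le> 2 * \<bar>?x i\<bar>" using \<beta> by (auto simp: abs_mult intro!: mult_right_mono)
      then show ?thesis using E[of i w] unfolding E_def by linarith
    qed
    have "0 \<le> K1" using x0 by linarith
    then have "\<bar>?x n\<bar> \<le> 4 * K1 + 4 * C1"
      using x0 s[of 0] s[of 1] C1 n by (auto simp: less_Suc_eq numeral_3_eq_3 numeral_2_eq_2)
    then show ?thesis by linarith
  qed
  then show ?thesis by blast
qed

text \<open>A state outside the bounded box has no continuation of value 0, so all words leading to
  such states share the empty residual; inside the box there are finitely many states.\<close>

lemma regular_lang_lin_val:
  fixes a b :: "'c \<Rightarrow> int"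
  assumes "\<And>c. \<bar>a c\<bar> \<le> B" "\<And>c. \<bar>b c\<bar> \<le> B"
  shows "regular_lang {w. lin_val a b 0 w = 0}"
proof -
  obtain K where K: "\<And>w v n. lin_val a b 0 (w @ v) = 0 \<Longrightarrow> n < 3 \<Longrightarrow> \<bar>lin_val a b n w\<bar> \<le> K"
    using lin_val_bounded[of a B b, OF assms] by blast
  define st where "st w = (lin_val a b 0 w, lin_val a b 1 w, lin_val a b 2 w)" for w
  define F where "F s = {v. \<exists>w. st w = s \<and> lin_val a b 0 (w @ v) = 0}" for s
  have st: "lin_val a b n w = lin_val a b n w'" if "st w = st w'" for n w w'
  proof (rule lin_val_state, intro allI impI)
    fix n :: nat assume "n < 3"
    then have "n = 0 \<or> n = 1 \<or> n = 2" by auto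
    then show "lin_val a b n w = lin_val a b n w'" using that unfolding st_def by auto
  qed
  have res: "{v. w @ v \<in> {w. lin_val a b 0 w = 0}} = F (st w)" for w
  proof -
    have "lin_val a b 0 (w @ v) = lin_val a b 0 (w' @ v)" if "st w' = st w" for w' v
      unfolding lin_val_append using st[OF that] by simp
    then show ?thesis unfolding F_def mem_Collect_eq by (intro Collect_cong) metis
  qed
  have "F (st w) \<in> insert {} (F ` ({-K..K} \<times> {-K..K} \<times> {-K..K}))" for w
  proof (cases "F (st w) = {}")
    case False
    then obtain v where "lin_val a b 0 (w @ v) = 0" using res[of w] by auto
    then have "st w \<in> {-K..K} \<times> {-K..K} \<times> {-K..K}"
      using K[of w v 0] K[of w v 1] K[of w v 2] unfolding st_def by (simp add: abs_le_iff)
    then show ?thesis by (intro insertI2 imageI)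
  qed simp
  then have "range (\<lambda>w. F (st w)) \<subseteq> insert {} (F ` ({-K..K} \<times> {-K..K} \<times> {-K..K}))"
    by (rule image_subsetI)
  then show ?thesis unfolding regular_lang_def res by (rule finite_subset) simp
qed

subsection \<open>Recognizable relations\<close>

text \<open>A word over the alphabet \<^typ>\<open>nat \<Rightarrow> bool\<close> carries one binary digit string per variable.
  Variables are de Bruijn indices.\<close>
definition vals :: "(nat \<Rightarrow> bool) list \<Rightarrow> nat \<Rightarrow> nat" where
  "vals w x = trib_val (map (\<lambda>c. of_bool (c x)) w)"

definition recog :: "((nat \<Rightarrow> nat) \<Rightarrow> bool) \<Rightarrow> bool" where
  "recog P \<longleftrightarrow> regular_lang {w. P (vals w)}"

lemma recog_not: "recog P \<Longrightarrow> recog (\<lambda>r. \<not> P r)"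
  unfolding recog_def by (drule regular_lang_Compl) (simp add: Collect_neg_eq)

lemma recog_conj: "recog P \<Longrightarrow> recog Q \<Longrightarrow> recog (\<lambda>r. P r \<and> Q r)"
  unfolding recog_def by (drule (1) regular_lang_Int) (simp add: Collect_conj_eq)

lemma recog_disj: "recog P \<Longrightarrow> recog Q \<Longrightarrow> recog (\<lambda>r. P r \<or> Q r)"
  using recog_not[OF recog_conj[OF recog_not recog_not], of P Q] by simp

lemma recog_imp: "recog P \<Longrightarrow> recog Q \<Longrightarrow> recog (\<lambda>r. P r \<longrightarrow> Q r)"
  using recog_disj[OF recog_not, of P Q] by simp

lemma recog_iff: "recog P \<Longrightarrow> recog Q \<Longrightarrow> recog (\<lambda>r. P r \<longleftrightarrow> Q r)"
  unfolding iff_conv_conj_imp by (intro recog_conj recog_imp)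

lemma recog_rename: "recog P \<Longrightarrow> recog (\<lambda>r. P (\<lambda>x. r (\<pi> x)))"
proof -
  assume P: "recog P"
  have "vals (map (\<lambda>c x. c (\<pi> x)) w) = (\<lambda>x. vals w (\<pi> x))" for w
    by (auto simp: vals_def comp_def)
  then show ?thesis
    using regular_lang_vimage_map[OF P[unfolded recog_def], of "\<lambda>c x. c (\<pi> x)"] by (simp add: recog_def)
qed

lemma recog_ex:
  assumes "recog (\<lambda>r. Q (r 0) (\<lambda>x. r (Suc x)))"
  shows "recog (\<lambda>r. \<exists>a. Q a r)"
proof -
  let ?L = "{w. Q (vals w 0) (\<lambda>x. vals w (Suc x))}"
  define h :: "(nat \<Rightarrow> bool) \<Rightarrow> nat \<Rightarrow> bool" where "h c = (\<lambda>x. c (Suc x))" for c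
  define z :: "nat \<Rightarrow> bool" where "z = (\<lambda>_. False)"
  have h: "vals (map h w) = (\<lambda>x. vals w (Suc x))" for w by (auto simp: vals_def h_def comp_def)
  have z: "vals (replicate m z @ w) = vals w" for m w by (auto simp: vals_def z_def)
  have "(\<exists>a. Q a (vals w)) \<longleftrightarrow> (\<exists>m w'. map h w' = replicate m z @ w \<and> w' \<in> ?L)" for w
  proof
    assume "\<exists>m w'. map h w' = replicate m z @ w \<and> w' \<in> ?L"
    then obtain m w' where w': "map h w' = replicate m z @ w" "w' \<in> ?L" by blast
    have "(\<lambda>x. vals w' (Suc x)) = vals w" using w'(1) h[of w'] z[of m w] by simp
    then show "\<exists>a. Q a (vals w)" using w'(2) by auto
  next
    assume "\<exists>a. Q a (vals w)"
    then obtain a where a: "Q a (vals w)" by blast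
    obtain u where u: "set u \<subseteq> {0, 1}" "trib_val u = a" using trib_val_surj by blast
    \<comment> \<open>The digits of a become track 0 and the tracks of w move up by one; whichever
      of the two words is shorter is padded with leading zeros.\<close>
    define u' where "u' = replicate (length w - length u) 0 @ u"
    define m where "m = length u - length w"
    define w' where "w' = map2 (\<lambda>d c. case_nat (d = 1) c) u' (replicate m z @ w)"
    have len: "length u' = length (replicate m z @ w)" by (simp add: u'_def m_def)
    have "map h w' = map snd (zip u' (replicate m z @ w))"
      by (auto simp: w'_def h_def)
    then have hw': "map h w' = replicate m z @ w" by (simp only: map_snd_zip len)
    have "map (\<lambda>c. of_bool (c 0)) w' = map (\<lambda>(d, c). of_bool (d = 1)) (zip u' (replicate m z @ w))"
      by (auto simp: w'_def)
    also have "\<dots> = map fst (zip u' (replicate m z @ w))"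
      by (rule map_cong) (use u(1) in \<open>auto simp: u'_def dest!: set_zip_leftD\<close>)
    finally have "vals w' 0 = a" unfolding vals_def by (simp only: map_fst_zip len) (simp add: u'_def u)
    moreover have "(\<lambda>x. vals w' (Suc x)) = vals w" using hw' h[of w'] z[of m w] by simp
    ultimately have "w' \<in> ?L" using a by simp
    then show "\<exists>m w'. map h w' = replicate m z @ w \<and> w' \<in> ?L" using hw' by blast
  qed
  then show ?thesis
    using regular_lang_project[OF assms[unfolded recog_def], of h z] by (simp add: recog_def)
qed

lemma recog_all:
  assumes "recog (\<lambda>r. Q (r 0) (\<lambda>x. r (Suc x)))"
  shows "recog (\<lambda>r. \<forall>a. Q a r)"
  using recog_not[OF recog_ex[of "\<lambda>a r. \<not> Q a r", OF recog_not[OF assms]]] by simp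

section \<open>Definable functions and arithmetic on values\<close>

definition definable :: "((nat \<Rightarrow> nat) \<Rightarrow> nat) \<Rightarrow> bool" where
  "definable f \<longleftrightarrow> recog (\<lambda>r. f (\<lambda>x. r (Suc x)) = r 0)"

lemma recog_subst:
  assumes "recog (\<lambda>r. Q (r 0) (\<lambda>x. r (Suc x)))" "definable f"
  shows "recog (\<lambda>r. Q (f r) r)"
  using recog_ex[of "\<lambda>a r. f r = a \<and> Q a r"] recog_conj[OF assms(2)[unfolded definable_def] assms(1)]
  by simp

lemma definable_rename: "definable f \<Longrightarrow> definable (\<lambda>r. f (\<lambda>x. r (\<pi> x)))"
  using recog_rename[of "\<lambda>r. f (\<lambda>x. r (Suc x)) = r 0" "case_nat 0 (\<lambda>x. Suc (\<pi> x))"]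
  by (simp add: definable_def)

lemma recog_subst2:
  assumes "recog (\<lambda>r. R (r 0) (r 1))" "definable f" "definable g"
  shows "recog (\<lambda>r. R (f r) (g r))"
proof (rule recog_subst[OF _ assms(2)])
  have "recog (\<lambda>r. R (r 1) (r 0))"
    using recog_rename[OF assms(1), of "case_nat 1 (\<lambda>_. 0)"] by simp
  then show "recog (\<lambda>r. R (r 0) (g (\<lambda>x. r (Suc x))))"
    by (intro recog_subst[where Q = "\<lambda>a r. R (r 0) a", OF _ definable_rename[OF assms(3)]]) simp
qed

lemma definable_comp:
  assumes "recog (\<lambda>r. G (r 1) = r 0)" "definable f"
  shows "definable (\<lambda>r. G (f r))"
  unfolding definable_def
proof (rule recog_subst[where Q = "\<lambda>a r. G a = r 0", OF _ definable_rename[OF assms(2)]])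
  show "recog (\<lambda>r. G (r 0) = r (Suc 0))"
    using recog_rename[OF assms(1), of "case_nat 1 (\<lambda>_. 0)"] by simp
qed

text \<open>Addition is a single linear equation between digit strings. Digitwise it has digits
  between -1 and 2, and the finite state takes care of all carries.\<close>

lemma recog_add: "recog (\<lambda>r. r 0 + r 1 = r 2)"
proof -
  define A :: "(nat \<Rightarrow> bool) \<Rightarrow> int" where "A c = of_bool (c 0) + of_bool (c 1) - of_bool (c 2)" for c
  have "lin_val A (\<lambda>_. 0) 0 w = int (vals w 0) + int (vals w 1) - int (vals w 2)" for w
    by (induction w) (auto simp: vals_def A_def algebra_simps)
  then have "{w. vals w 0 + vals w 1 = vals w 2} = {w. lin_val A (\<lambda>_. 0) 0 w = 0}" by auto
  then show ?thesis unfolding recog_def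
    using regular_lang_lin_val[of A 2 "\<lambda>_. 0"] by (simp add: A_def)
qed

lemma recog_eq_var: "recog (\<lambda>r. r 0 = r 1)"
proof -
  define A :: "(nat \<Rightarrow> bool) \<Rightarrow> int" where "A c = of_bool (c 0) - of_bool (c 1)" for c
  have "lin_val A (\<lambda>_. 0) 0 w = int (vals w 0) - int (vals w 1)" for w
    by (induction w) (auto simp: vals_def A_def algebra_simps)
  then have "{w. vals w 0 = vals w 1} = {w. lin_val A (\<lambda>_. 0) 0 w = 0}" by auto
  then show ?thesis unfolding recog_def
    using regular_lang_lin_val[of A 2 "\<lambda>_. 0"] by (simp add: A_def)
qed

text \<open>Shifting a representation turns each \<open>trib_num i\<close> into
  \<open>trib_num (i + 1)\<close>, which is what the second coefficient of \<open>lin_val\<close> is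
  for.\<close>

lemma recog_sub_len: "recog (\<lambda>r. sub_len (r 1) = r 0)"
proof -
  define A :: "(nat \<Rightarrow> bool) \<Rightarrow> int" where "A c = - of_bool (c 0)" for c
  define A' :: "(nat \<Rightarrow> bool) \<Rightarrow> int" where "A' c = of_bool (c 1)" for c
  have s: "sub_len (vals w 1) = trib_val (map (\<lambda>c. of_bool (c 1)) w @ [0])" for w
    unfolding vals_def by (rule sub_len_trib_val) auto
  have "lin_val A A' 0 w = int (trib_val (map (\<lambda>c. of_bool (c 1)) w @ [0])) - int (vals w 0)" for w
    by (induction w) (auto simp: vals_def A_def A'_def algebra_simps)
  then have "{w. sub_len (vals w 1) = vals w 0} = {w. lin_val A A' 0 w = 0}" unfolding s by auto
  then show ?thesis unfolding recog_def
    using regular_lang_lin_val[of A 2 A'] by (simp add: A_def A'_def)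
qed

lemma definable_var: "definable (\<lambda>r. r x)"
  unfolding definable_def using recog_rename[OF recog_eq_var, of "case_nat (Suc x) (\<lambda>_. 0)"] by simp

lemma recog_eq: "definable f \<Longrightarrow> definable g \<Longrightarrow> recog (\<lambda>r. f r = g r)"
  by (rule recog_subst2[OF recog_eq_var])

lemma definable_sub_len: "definable f \<Longrightarrow> definable (\<lambda>r. sub_len (f r))"
  by (rule definable_comp[OF recog_sub_len])

lemma definable_add:
  assumes "definable f" "definable g" shows "definable (\<lambda>r. f r + g r)"
proof -
  have "recog (\<lambda>r. r 1 + r 0 = r (Suc (Suc 0)))"
    using recog_rename[OF recog_add, of "case_nat 1 (case_nat 0 (\<lambda>_. 2))"] by (simp add: numeral_2_eq_2)
  then have "recog (\<lambda>r. r 0 + g (\<lambda>x. r (Suc (Suc x))) = r (Suc 0))"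
    by (intro recog_subst[where Q = "\<lambda>a r. r 0 + a = r (Suc 0)", OF _ definable_rename[OF assms(2)]]) simp
  then show ?thesis unfolding definable_def
    by (rule recog_subst[where Q = "\<lambda>a r. a + g (\<lambda>x. r (Suc x)) = r 0", OF _ definable_rename[OF assms(1)]])
qed

lemma recog_le: "definable f \<Longrightarrow> definable g \<Longrightarrow> recog (\<lambda>r. f r \<le> g r)"
  unfolding le_iff_add
  by (intro recog_ex recog_eq definable_add definable_var)
    (erule definable_rename)+

lemma recog_less: "definable f \<Longrightarrow> definable g \<Longrightarrow> recog (\<lambda>r. f r < g r)"
  unfolding not_le[symmetric] by (intro recog_not recog_le)

lemma definable_0: "definable (\<lambda>r. 0)"
  unfolding definable_def using recog_rename[OF recog_add, of "\<lambda>_. 0"] by simp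

lemma definable_1: "definable (\<lambda>r. 1)"
proof -
  have "recog (\<lambda>r. 0 < r 0 \<and> (\<forall>y. 0 < y \<longrightarrow> r 0 \<le> y))"
    by (intro recog_conj recog_all recog_imp recog_less recog_le definable_0 definable_var)
  moreover have "0 < x \<and> (\<forall>y. 0 < y \<longrightarrow> x \<le> y) \<longleftrightarrow> 1 = x" for x :: nat
    by (auto intro!: le_antisym)
  ultimately show ?thesis unfolding definable_def by simp
qed

lemma definable_Suc: "definable f \<Longrightarrow> definable (\<lambda>r. Suc (f r))"
  using definable_add[OF _ definable_1] by simp

lemmas recog_intros = recog_not recog_conj recog_disj recog_imp recog_iff recog_ex recog_all
  recog_eq recog_le recog_less definable_var definable_0 definable_1 definable_Suc definable_add
  definable_sub_len

text \<open>A fixed cardinality is expressed by removing least elements one at a time: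
  \<open>Q'\<close> keeps exactly the elements that have a smaller one.\<close>

lemma recog_card:
  assumes "recog (\<lambda>r. Q (r 0) (\<lambda>x. r (Suc x)))" "\<And>r. finite {a. Q a r}"
  shows "recog (\<lambda>r. card {a. Q a r} = c)"
  using assms
proof (induction c arbitrary: Q)
  case 0
  have "recog (\<lambda>r. \<not> (\<exists>a. Q a r))" by (intro recog_not recog_ex 0)
  then show ?case using 0(2) by simp
next
  case (Suc c)
  define Q' where "Q' a r \<longleftrightarrow> Q a r \<and> (\<exists>b. b < a \<and> Q b r)" for a r
  have "recog (\<lambda>r. Q (r 0) (\<lambda>x. r (Suc (Suc x))))"
    using recog_rename[OF Suc.prems(1), of "case_nat 0 (\<lambda>x. Suc (Suc x))"] by simp
  then have "recog (\<lambda>r. Q' (r 0) (\<lambda>x. r (Suc x)))"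
    unfolding Q'_def by (intro recog_conj recog_ex recog_less definable_var Suc.prems)
  moreover have "finite {a. Q' a r}" for r
    by (rule finite_subset[OF _ Suc.prems(2)[of r]]) (auto simp: Q'_def)
  ultimately have IH: "recog (\<lambda>r. card {a. Q' a r} = c)" by (rule Suc.IH)
  have "card {a. Q a r} = Suc c \<longleftrightarrow> (\<exists>a. Q a r) \<and> card {a. Q' a r} = c" for r
  proof (cases "\<exists>a. Q a r")
    case True
    then have l: "Q (LEAST a. Q a r) r" by (rule LeastI_ex)
    have "{a. Q' a r} = {a. Q a r} - {LEAST a. Q a r}"
      using l not_less_Least by (auto simp: Q'_def) (metis Least_le le_less)
    then have "card {a. Q' a r} = card {a. Q a r} - 1" using l Suc.prems(2) by simp
    moreover have "card {a. Q a r} > 0" using True Suc.prems(2) by (auto simp: card_gt_0_iff)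
    ultimately show ?thesis using True by auto
  qed auto
  moreover have "recog (\<lambda>r. (\<exists>a. Q a r) \<and> card {a. Q' a r} = c)"
    by (intro recog_conj recog_ex Suc.prems IH)
  ultimately show ?case by simp
qed

subsection \<open>From recognizable level sets to automata with output\<close>

text \<open>A single state has to follow all level sets of a function at once; it records the
  residuals of finitely many languages side by side.\<close>

lemma finite_joint_residuals:
  assumes "finite A" "\<And>c. c \<in> A \<Longrightarrow> regular_lang (L c)"
  shows "finite (range (\<lambda>w. {(c, v). c \<in> A \<and> w @ v \<in> L c}))"
  using assms
proof (induction A)
  case empty
  then show ?case by simp
next
  case (insert d A)
  let ?F = "\<lambda>A w. {(c, v). c \<in> A \<and> w @ v \<in> L c}"
  have eq: "?F (insert d A) w = {d} \<times> {v. w @ v \<in> L d} \<union> ?F A w" for w by auto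
  then have "range (?F (insert d A)) \<subseteq>
      (\<lambda>(R, S). {d} \<times> R \<union> S) ` (range (\<lambda>w. {v. w @ v \<in> L d}) \<times> range (?F A))"
    unfolding eq by fast
  moreover have "finite (range (\<lambda>w. {v. w @ v \<in> L d}) \<times> range (?F A))"
    using insert by (auto simp: regular_lang_def)
  ultimately show ?case by (meson finite_imageI finite_subset)
qed

text \<open>The bound leaves finitely many level sets. States are their joint residuals, numbered by
  an injection into the naturals, and the output is the level set whose residual contains the empty
  word.\<close>

lemma trib_automatic2I:
  fixes F :: "nat \<Rightarrow> nat \<Rightarrow> int"
  assumes rec: "\<And>c. recog (\<lambda>r. F (r 0) (r 1) = c)"
    and bound: "\<And>k n. D k n \<Longrightarrow> \<bar>F k n\<bar> \<le> B"
  shows "trib_automatic2 D F"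
proof -
  define L where "L c = {w. F (vals w 0) (vals w 1) = c}" for c
  define St where "St w = {(c, v). c \<in> {-B..B} \<and> w @ v \<in> L c}" for w
  have fin: "finite (range St)" unfolding St_def
    by (rule finite_joint_residuals) (use rec in \<open>auto simp: recog_def L_def\<close>)
  obtain h :: "(int \<times> (nat \<Rightarrow> bool) list) set \<Rightarrow> nat" where h: "inj_on h (range St)"
    using finite_imp_inj_to_nat_seg[OF fin] by blast
  define col :: "nat \<times> nat \<Rightarrow> nat \<Rightarrow> bool" where
    "col p x = (if x = 0 then fst p = 1 else snd p = 1)" for p x
  define rep where "rep q = (SOME w. h (St w) = q)" for q
  \<comment> \<open>The chosen word \<open>rep q\<close> is immaterial, since the residuals after
    one more letter depend only on the residuals before it.\<close>
  define delta where "delta q p = h (St (rep q @ [col p]))" for q p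
  define out where "out q = (SOME c. (c, []) \<in> St (rep q))" for q
  have rep: "St (rep (h (St w))) = St w" for w
  proof -
    have "h (St (rep (h (St w)))) = h (St w)" unfolding rep_def by (rule someI) simp
    then show ?thesis using h by (auto dest: inj_onD)
  qed
  have St_snoc: "St (w @ [c]) = {(d, v). (d, c # v) \<in> St w}" for w c by (simp add: St_def)
  have run: "foldl delta (h (St [])) ps = h (St (map col ps))" for ps
    by (induction ps rule: rev_induct) (simp_all add: delta_def St_snoc rep)
  have out: "out (foldl delta (h (St [])) (zip u v)) = F (trib_val u) (trib_val v)"
    if "D (trib_val u) (trib_val v)" "trib_valid u" "trib_valid v" "length u = length v" for u v
  proof -
    have "set u \<subseteq> {0, 1}" "set v \<subseteq> {0, 1}" using that by (auto simp: trib_valid_def)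
    with that(4) have "map (\<lambda>c. of_bool (c 0)) (map col (zip u v)) = u \<and>
        map (\<lambda>c. of_bool (c 1)) (map col (zip u v)) = v"
      by (induction u v rule: list_induct2) (auto simp: col_def)
    then have v: "vals (map col (zip u v)) 0 = trib_val u" "vals (map col (zip u v)) 1 = trib_val v"
      unfolding vals_def by simp_all
    have "(c, []) \<in> St (map col (zip u v)) \<longleftrightarrow> c = F (trib_val u) (trib_val v)" for c
      using bound[OF that(1)] v by (auto simp: St_def L_def abs_le_iff)
    then show ?thesis by (simp add: run out_def rep)
  qed
  show ?thesis unfolding trib_automatic2_def
  proof (intro exI[of _ "h ` range St"] exI[of _ "h (St [])"] exI[of _ delta] exI[of _ out] conjI allI ballI impI)
    show "finite (h ` range St)" using fin by (rule finite_imageI)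
    show "delta q (a, b) \<in> h ` range St" for q a b by (auto simp: delta_def)
  qed (use out in auto)
qed

subsection \<open>k-abelian equivalence of factors\<close>

text \<open>The two factors are given by starting positions. Differences of letter counts are
  rearranged into sums, which keeps the relation first-order over addition of naturals; the count of
  2 follows from the common length.\<close>

definition kab_cong :: "nat \<Rightarrow> nat \<Rightarrow> nat \<Rightarrow> nat \<Rightarrow> bool" where
  "kab_cong k n i j \<longleftrightarrow>
     (\<forall>l<n. l + 1 < k \<or> n < l + k \<longrightarrow> trib_word (i + l) = trib_word (j + l)) \<and>
     letter_count 0 (i + n) + letter_count 0 j = letter_count 0 (j + n) + letter_count 0 i \<and>
     letter_count 1 (i + n) + letter_count 1 j = letter_count 1 (j + n) + letter_count 1 i"

lemma kab_cong_letter_count: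
  assumes "kab_cong k n i j" "a \<le> 2"
  shows "letter_count a (i + n) + letter_count a j = letter_count a (j + n) + letter_count a i"
proof -
  have 01: "letter_count 0 (i + n) + letter_count 0 j = letter_count 0 (j + n) + letter_count 0 i"
    "letter_count 1 (i + n) + letter_count 1 j = letter_count 1 (j + n) + letter_count 1 i"
    using assms(1) unfolding kab_cong_def by blast+
  have 2: "letter_count 2 (i + n) + letter_count 2 j = letter_count 2 (j + n) + letter_count 2 i"
    using 01 letter_count_sum[of i] letter_count_sum[of j] letter_count_sum[of "i + n"]
      letter_count_sum[of "j + n"] by linarith
  have "a = 0 \<or> a = 1 \<or> a = 2" using assms(2) by auto
  then show ?thesis using 01 2 by metis
qed

section \<open>Balance equations for occurrence counts\<close>

lemma occ_window:
  "occ (window i n) w = card {x. x + length w \<le> n \<and> window (i + x) (length w) = w}"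
proof -
  have "take (length w) (drop x (window i n)) = window (i + x) (length w)" if "x + length w \<le> n" for x
    using that by (intro nth_equalityI) (auto simp: add.assoc)
  then show ?thesis unfolding occ_def by (intro arg_cong[of _ _ card]) auto
qed

lemma finite_occ: "finite {x. x + h \<le> n \<and> P x}" for n h :: nat
  by (rule finite_subset[of _ "{..n}"]) auto

lemma occ_not_factor:
  assumes "\<And>p. window p (length w) \<noteq> w" shows "occ (window i n) w = 0"
  using assms by (simp add: occ_window)

lemma occ_letter: "occ (window i n) [a] + letter_count a i = letter_count a (i + n)"
proof (induction n)
  case 0
  have "{x. x + length [a] \<le> 0 \<and> window (i + x) (length [a]) = [a]} = {}" by auto
  then show ?case unfolding occ_window by simp
next
  case (Suc n)
  have "{x. x + length [a] \<le> Suc n \<and> window (i + x) (length [a]) = [a]} =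
      {x. x + length [a] \<le> n \<and> window (i + x) (length [a]) = [a]} \<union>
      (if trib_word (i + n) = a then {n} else {})"
    by (auto simp: window_Suc less_Suc_eq le_Suc_eq)
  then have "occ (window i (Suc n)) [a] = occ (window i n) [a] + (if trib_word (i + n) = a then 1 else 0)"
    unfolding occ_window by (subst card_Un_disjoint[symmetric] | simp add: finite_occ[where h = "length [a]", simplified])+
  then show ?case using Suc by (simp add: letter_count_Suc)
qed

text \<open>Each occurrence of y is preceded by exactly one letter inside the window, unless it is
  at the start; the correction term accounts for that occurrence.\<close>

lemma occ_Cons_sum:
  "(\<Sum>a\<le>2. occ (window i n) (a # y)) + (if length y \<le> n \<and> window i (length y) = y then 1 else 0)
     = occ (window i n) y"
proof -
  let ?h = "length y"
  let ?S = "\<lambda>a. {x. x + Suc ?h \<le> n \<and> window (i + x) (Suc ?h) = a # y}"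
  let ?Z = "if ?h \<le> n \<and> window i ?h = y then {0::nat} else {}"
  have "{x. x + ?h \<le> n \<and> window (i + x) ?h = y} = Suc ` (\<Union>a\<le>2. ?S a) \<union> ?Z" (is "?A = ?B")
  proof (intro equalityI subsetI)
    fix x assume x: "x \<in> ?A"
    show "x \<in> ?B"
    proof (cases x)
      case (Suc z)
      then have "z \<in> ?S (trib_word (i + z))" using x by (simp add: window_Suc)
      then have "z \<in> (\<Union>a\<le>2. ?S a)" using trib_word_le_2 by blast
      then show ?thesis using Suc by blast
    qed (use x in auto)
  qed (auto simp: window_Suc split: if_splits)
  then have "occ (window i n) y = card (Suc ` (\<Union>a\<le>2. ?S a) \<union> ?Z)" by (simp add: occ_window)
  also have "\<dots> = card (Suc ` (\<Union>a\<le>2. ?S a)) + card ?Z"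
  proof (rule card_Un_disjoint)
    show "finite (Suc ` (\<Union>a\<le>2. ?S a))" by (intro finite_imageI finite_UN_I finite_atMost finite_occ)
  qed auto
  also have "card (Suc ` (\<Union>a\<le>2. ?S a)) = card (\<Union>a\<le>2. ?S a)" by (rule card_image) simp
  also have "\<dots> = (\<Sum>a\<le>2. card (?S a))"
    by (rule card_UN_disjoint) (intro finite_atMost ballI finite_occ | auto)+
  finally show ?thesis by (simp add: occ_window)
qed

lemma occ_snoc_sum:
  "(\<Sum>b\<le>2. occ (window i n) (y @ [b])) + (if length y \<le> n \<and> window (i + n - length y) (length y) = y then 1 else 0)
     = occ (window i n) y"
proof -
  let ?h = "length y"
  let ?S = "\<lambda>b. {x. x + Suc ?h \<le> n \<and> window (i + x) (Suc ?h) = y @ [b]}"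
  let ?Z = "if ?h \<le> n \<and> window (i + n - ?h) ?h = y then {n - ?h} else {}"
  have "{x. x + ?h \<le> n \<and> window (i + x) ?h = y} = (\<Union>b\<le>2. ?S b) \<union> ?Z" (is "?A = ?B")
  proof (intro equalityI subsetI)
    fix x assume x: "x \<in> ?A"
    show "x \<in> ?B"
    proof (cases "x + ?h = n")
      case True
      then have "x = n - ?h" "i + x = i + n - ?h" by auto
      then show ?thesis using x by auto
    next
      case False
      then have "x \<in> ?S (trib_word (i + x + ?h))" using x by (simp add: window_snoc)
      then have "x \<in> (\<Union>b\<le>2. ?S b)" using trib_word_le_2 by blast
      then show ?thesis by blast
    qed
  qed (auto simp: window_snoc split: if_splits)
  then have "occ (window i n) y = card ((\<Union>b\<le>2. ?S b) \<union> ?Z)" by (simp add: occ_window)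
  also have "\<dots> = card (\<Union>b\<le>2. ?S b) + card ?Z"
  proof (rule card_Un_disjoint)
    show "finite (\<Union>b\<le>2. ?S b)" by (intro finite_UN_I finite_atMost finite_occ)
  qed auto
  also have "card (\<Union>b\<le>2. ?S b) = (\<Sum>b\<le>2. card (?S b))"
    by (rule card_UN_disjoint) (intro finite_atMost ballI finite_occ | auto)+
  finally show ?thesis by (simp add: occ_window)
qed

text \<open>A factor a y with y not left special occurs wherever y occurs, except
  at the start. If y is left special, then it is the only left special word of its length,
  so the other right extensions of the prefix of a y fall under the first case.\<close>
lemma occ_eq_of_kab_cong:
  assumes E: "kab_cong k n i j"
  shows "length w \<le> k \<Longrightarrow> occ (window i n) w = occ (window j n) w"
proof (induction "length w" arbitrary: w rule: less_induct)
  case less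
  have pre: "length y \<le> n \<and> window i (length y) = y \<longleftrightarrow> length y \<le> n \<and> window j (length y) = y"
    if "length y < k" for y
  proof (cases "length y \<le> n")
    case True
    then have "window i (length y) = window j (length y)"
      using E that unfolding window_eq_iff kab_cong_def by auto
    then show ?thesis by simp
  qed simp
  have suf: "length y \<le> n \<and> window (i + n - length y) (length y) = y \<longleftrightarrow>
      length y \<le> n \<and> window (j + n - length y) (length y) = y"
    if "length y < k" for y
  proof (cases "length y \<le> n")
    case True
    have "trib_word (i + n - length y + l) = trib_word (j + n - length y + l)" if "l < length y" for l
    proof -
      have "i + n - length y + l = i + (n - length y + l)" "j + n - length y + l = j + (n - length y + l)"
        "n - length y + l < n" "n < n - length y + l + k"
        using True that \<open>length y < k\<close> by auto
      then show ?thesis using E unfolding kab_cong_def by metis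
    qed
    then have "window (i + n - length y) (length y) = window (j + n - length y) (length y)"
      by (simp add: window_eq_iff)
    then show ?thesis by simp
  qed simp
  have nonspecial: "occ (window i n) (a # y) = occ (window j n) (a # y)"
    if len: "length (a # y) = length w" and ns: "\<And>p q. window (Suc p) (length y) = y \<Longrightarrow>
      window (Suc q) (length y) = y \<Longrightarrow> trib_word p = trib_word q" for a y
  proof (cases "\<exists>p. window p (Suc (length y)) = a # y")
    case False
    then show ?thesis using occ_not_factor[of "a # y"] by simp
  next
    case True
    then obtain p where p: "trib_word p = a" "window (Suc p) (length y) = y" by (auto simp: window_Suc)
    then have a2: "a \<le> 2" using trib_word_le_2 by blast
    have zero: "occ (window i n) (b # y) = 0" if "b \<noteq> a" for b i
    proof (rule occ_not_factor, rule notI)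
      fix q assume "window q (length (b # y)) = b # y"
      then have "trib_word q = b" "window (Suc q) (length y) = y" by (auto simp: window_Suc)
      then show False using ns[of p q] p that by metis
    qed
    have "(\<Sum>b\<le>2. occ (window i n) (b # y)) = occ (window i n) (a # y)" for i
      using a2 zero[of _ i] by (subst sum.remove[of _ a]) (auto intro!: sum.neutral)
    then have "occ (window i n) (a # y) + (if length y \<le> n \<and> window i (length y) = y then 1 else 0)
        = occ (window i n) y" for i
      using occ_Cons_sum[of i n y] by simp
    from this[of i] this[of j] show ?thesis
      using less.hyps[of y] less.prems len pre[of y] by (simp split: if_splits)
  qed
  consider "length w = 0" | a where "w = [a]" | a y where "w = a # y" "y \<noteq> []"
    by (cases w) auto
  then show ?case
  proof cases
    case 1
    then show ?thesis by (simp add: occ_window)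
  next
    case (2 a)
    show ?thesis
    proof (cases "a \<le> 2")
      case True
      show ?thesis unfolding 2
        using occ_letter[of i n a] occ_letter[of j n a] kab_cong_letter_count[OF E True] by linarith
    next
      case False
      then have "window p (length [a]) \<noteq> [a]" for p using trib_word_le_2[of p] by (auto simp: window_Suc)
      then show ?thesis unfolding 2 using occ_not_factor[of "[a]"] by simp
    qed
  next
    case (3 a y)
    show ?thesis
    proof (cases "\<exists>p q. window (Suc p) (length y) = y \<and> window (Suc q) (length y) = y \<and> trib_word p \<noteq> trib_word q")
      case False
      show ?thesis unfolding 3(1)
      proof (rule nonspecial)
        show "length (a # y) = length w" by (simp add: 3(1))
      qed (use False in metis)
    next
      case True
      have special: "y' = window 0 (length y')"
        if "window (Suc p) (length y') = y'" "window (Suc q) (length y') = y'" "trib_word p \<noteq> trib_word q" for y' p q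
        using left_special_prefix[OF that(3), of "length y'"] that(1,2)
        by (metis add.left_neutral window_eq_iff)
      have y: "y = window 0 (length y)" using True special by blast
      obtain x b where xb: "w = x @ [b]" using 3(1) by (metis append_butlast_last_id list.distinct(1))
      obtain x' where x': "x = a # x'" using xb 3 by (cases x) auto
      have yb: "y = x' @ [b]" using 3(1) xb x' by simp
      have other: "occ (window i n) (x @ [b']) = occ (window j n) (x @ [b'])" if "b' \<noteq> b" for b'
      proof -
        have "x' @ [b'] \<noteq> window 0 (length (x' @ [b']))"
          using y yb that by (metis append1_eq_conv length_append_singleton)
        then have "occ (window i n) (a # x' @ [b']) = occ (window j n) (a # x' @ [b'])"
          using special 3(1) yb by (intro nonspecial) (simp, blast)
        then show ?thesis by (simp add: x')
      qed
      show ?thesis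
      proof (cases "b \<le> 2")
        case True
        \<comment> \<open>The balance of the right extensions of x isolates b, because the
          correction at the end is the same for both factors by \<open>suf\<close>.\<close>
        have *: "occ (window i n) (x @ [b]) + (\<Sum>b'\<in>{..2} - {b}. occ (window i n) (x @ [b'])) =
            (\<Sum>b'\<le>2. occ (window i n) (x @ [b']))" for i
          using True by (subst (2) sum.remove[of _ b]) auto
        have "(\<Sum>b'\<in>{..2} - {b}. occ (window i n) (x @ [b'])) = (\<Sum>b'\<in>{..2} - {b}. occ (window j n) (x @ [b']))"
          by (rule sum.cong) (use other in auto)
        moreover have "occ (window i n) x = occ (window j n) x"
          using less.hyps[of x] less.prems xb by simp
        moreover have "length x < k" using less.prems xb by simp
        ultimately show ?thesis unfolding xb
          using *[of i] *[of j] occ_snoc_sum[of i n x] occ_snoc_sum[of j n x] suf[of x]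
          by (simp split: if_splits)
      next
        case False
        have "window p (length w) \<noteq> w" for p
          using xb False trib_word_le_2 by (auto simp: window_snoc)
        then show ?thesis using occ_not_factor[of w] by simp
      qed
    qed
  qed
qed

text \<open>In the balance equations the counts of words up to length k determine the correction
  terms for words of length at most k - 1, and these tell which word is the prefix and which is the
  suffix.\<close>

lemma kab_cong_of_occ_eq:
  assumes k: "1 \<le> k" and eq: "\<And>w. length w \<le> k \<Longrightarrow> occ (window i n) w = occ (window j n) w"
  shows "kab_cong k n i j"
proof -
  define h where "h = min (k - 1) n"
  have h: "h < k" "h \<le> n" using k by (auto simp: h_def)
  have pre: "window j h = window i h"
  proof -
    let ?y = "window i h"
    have "(\<Sum>a\<le>2. occ (window i n) (a # ?y)) = (\<Sum>a\<le>2. occ (window j n) (a # ?y))"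
      by (rule sum.cong) (use eq h in auto)
    then show ?thesis
      using occ_Cons_sum[of i n ?y] occ_Cons_sum[of j n ?y] eq[of ?y] h by (simp split: if_splits)
  qed
  have suf: "window (j + n - h) h = window (i + n - h) h"
  proof -
    let ?y = "window (i + n - h) h"
    have "(\<Sum>b\<le>2. occ (window i n) (?y @ [b])) = (\<Sum>b\<le>2. occ (window j n) (?y @ [b]))"
      by (rule sum.cong) (use eq h in auto)
    then show ?thesis
      using occ_snoc_sum[of i n ?y] occ_snoc_sum[of j n ?y] eq[of ?y] h by (simp split: if_splits)
  qed
  have "trib_word (i + l) = trib_word (j + l)" if l: "l < n" "l + 1 < k \<or> n < l + k" for l
  proof (cases "l + 1 < k")
    case True
    then show ?thesis using pre l unfolding window_eq_iff h_def by auto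
  next
    case False
    then have "l = n - h + (l - (n - h)) \<and> l - (n - h) < h"
      using l h by (auto simp: h_def min_def split: if_splits)
    then obtain l' where l': "l = n - h + l'" "l' < h" by metis
    then have "i + l = i + n - h + l'" "j + l = j + n - h + l'" using h by auto
    then show ?thesis using suf l'(2) unfolding window_eq_iff by metis
  qed
  moreover have "letter_count a (i + n) + letter_count a j = letter_count a (j + n) + letter_count a i" for a
    using occ_letter[of i n a] occ_letter[of j n a] eq[of "[a]"] k by simp
  ultimately show ?thesis unfolding kab_cong_def by blast
qed

lemma k_abelian_eq_window_iff:
  "1 \<le> k \<Longrightarrow> k_abelian_eq k (window i n) (window j n) \<longleftrightarrow> kab_cong k n i j"
  unfolding k_abelian_eq_def using occ_eq_of_kab_cong kab_cong_of_occ_eq by blast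

text \<open>Least starting positions turn a count of classes of words into a count of numbers, to
  which \<open>recog_card\<close> applies. A finer equivalence gives a larger set.\<close>

definition min_reps :: "nat \<Rightarrow> nat \<Rightarrow> nat set" where
  "min_reps k n = {i. \<forall>j<i. \<not> kab_cong k n i j}"

lemma kab_cong_window: "window i n = window i' n \<Longrightarrow> kab_cong k n i i'"
  unfolding window_eq_iff kab_cong_def
  using letter_count_window_cong[of n i i' 0] letter_count_window_cong[of n i i' 1] by auto

lemma kab_cong_sym: "kab_cong k n i j \<Longrightarrow> kab_cong k n j i"
  unfolding kab_cong_def by metis

lemma kab_cong_trans: "kab_cong k n i j \<Longrightarrow> kab_cong k n j l \<Longrightarrow> kab_cong k n i l"
  unfolding kab_cong_def by auto

lemma finite_min_reps: "finite (min_reps k n)"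
proof (rule inj_on_finite)
  show "inj_on (\<lambda>i. window i n) (min_reps k n)"
    by (rule inj_onI) (metis (no_types, lifting) kab_cong_window mem_Collect_eq min_reps_def nat_neq_iff)
  show "(\<lambda>i. window i n) ` min_reps k n \<subseteq> range (\<lambda>i. window i n)" by blast
qed (rule finite_windows)

lemma kab_complexity_eq_card:
  assumes "1 \<le> k" shows "kab_complexity trib_word k n = card (min_reps k n)"
proof -
  let ?F = "factors_of_len trib_word n"
  let ?R = "{(u, v). u \<in> ?F \<and> v \<in> ?F \<and> k_abelian_eq k u v}"
  have F: "?F = range (\<lambda>i. window i n)" by (auto simp: factors_of_len_def window_def)
  have cl: "?R `` {window i n} = (\<lambda>j. window j n) ` {j. kab_cong k n i j}" for i
    using k_abelian_eq_window_iff[OF assms] unfolding F by auto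
  have "bij_betw (\<lambda>i. ?R `` {window i n}) (min_reps k n) (?F // ?R)"
    unfolding bij_betw_def
  proof
    show "inj_on (\<lambda>i. ?R `` {window i n}) (min_reps k n)"
    proof (rule inj_onI)
      fix i j assume i: "i \<in> min_reps k n" and j: "j \<in> min_reps k n"
        and eq: "?R `` {window i n} = ?R `` {window j n}"
      have "window j n \<in> ?R `` {window j n}" unfolding cl using kab_cong_window by (intro imageI) simp
      then have "window j n \<in> ?R `` {window i n}" unfolding eq .
      then have "window j n \<in> (\<lambda>j. window j n) ` {j. kab_cong k n i j}" unfolding cl .
      then obtain l where "window j n = window l n" "kab_cong k n i l" by (elim imageE) simp
      then have "kab_cong k n i j" using kab_cong_window kab_cong_trans by metis
      then have "\<not> j < i" "\<not> i < j"
        using i j kab_cong_sym[of k n i j] by (auto simp: min_reps_def)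
      then show "i = j" by simp
    qed
    show "(\<lambda>i. ?R `` {window i n}) ` min_reps k n = ?F // ?R"
    proof (intro equalityI subsetI)
      fix X assume "X \<in> ?F // ?R"
      then obtain i where X: "X = ?R `` {window i n}" unfolding quotient_def F by blast
      define m where "m = (LEAST j. kab_cong k n i j)"
      have im: "kab_cong k n i m" unfolding m_def by (rule LeastI[of _ i]) (simp add: kab_cong_window)
      have "m \<in> min_reps k n" unfolding min_reps_def
      proof (intro CollectI allI impI notI)
        fix j assume j: "j < m" "kab_cong k n m j"
        then have "kab_cong k n i j" using im kab_cong_trans by metis
        then show False using j(1) not_less_Least unfolding m_def by metis
      qed
      moreover have "X = ?R `` {window m n}"
      proof -
        have "kab_cong k n i j \<longleftrightarrow> kab_cong k n m j" for j
          using im kab_cong_trans kab_cong_sym by metis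
        then show ?thesis unfolding X cl by (intro arg_cong[of _ _ "(`) _"] Collect_cong)
      qed
      ultimately show "X \<in> (\<lambda>i. ?R `` {window i n}) ` min_reps k n" by blast
    next
      fix X assume "X \<in> (\<lambda>i. ?R `` {window i n}) ` min_reps k n"
      then obtain i where X: "X = ?R `` {window i n}" by (elim imageE)
      have "window i n \<in> ?F" unfolding F by simp
      then show "X \<in> ?F // ?R" unfolding X by (rule quotientI)
    qed
  qed
  from bij_betw_same_card[OF this, symmetric] show ?thesis unfolding kab_complexity_def .
qed

subsection \<open>Synchronization\<close>

text \<open>The error of each step is magnified by all later steps; the geometric sum is at most
  twice C times the power, as 1 / (\<beta> - 1) \<le> 2.\<close>

lemma sub_len_pow_approx:
  "\<exists>C\<ge>0. \<forall>m x. \<bar>real ((sub_len ^^ m) x) - trib_root ^ m * real x\<bar> \<le> C * trib_root ^ m"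
proof -
  obtain C where C: "C \<ge> 0" "\<And>n. \<bar>real (sub_len n) - trib_root * real n\<bar> \<le> C"
    using sub_len_approx by blast
  let ?\<beta> = trib_root
  have \<beta>: "9 / 5 \<le> ?\<beta>" by (rule trib_root_ge)
  have *: "\<bar>real ((sub_len ^^ m) x) - ?\<beta> ^ m * real x\<bar> \<le> 2 * C * (?\<beta> ^ m - 1)" for m x
  proof (induction m)
    case (Suc m)
    let ?y = "(sub_len ^^ m) x"
    have "\<bar>?\<beta> * (real ?y - ?\<beta> ^ m * real x)\<bar> \<le> ?\<beta> * (2 * C * (?\<beta> ^ m - 1))"
      using Suc \<beta> by (simp add: abs_mult)
    moreover have "real ((sub_len ^^ Suc m) x) - ?\<beta> ^ Suc m * real x =
        (real (sub_len ?y) - ?\<beta> * real ?y) + ?\<beta> * (real ?y - ?\<beta> ^ m * real x)"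
      by (simp add: algebra_simps)
    ultimately have "\<bar>real ((sub_len ^^ Suc m) x) - ?\<beta> ^ Suc m * real x\<bar> \<le> C + ?\<beta> * (2 * C * (?\<beta> ^ m - 1))"
      using C(2)[of ?y] by linarith
    also have "\<dots> = 2 * C * (?\<beta> ^ Suc m - 1) + C * (3 - 2 * ?\<beta>)" by (simp add: algebra_simps)
    also have "\<dots> \<le> 2 * C * (?\<beta> ^ Suc m - 1)" using C(1) \<beta> by (simp add: mult_nonneg_nonpos)
    finally show ?case .
  qed simp
  have "\<bar>real ((sub_len ^^ m) x) - ?\<beta> ^ m * real x\<bar> \<le> 2 * C * ?\<beta> ^ m" for m x
    using *[of m x] C(1) by (simp add: algebra_simps)
  then show ?thesis using C(1) by (intro exI[of _ "2 * C"]) auto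
qed

text \<open>One desubstitution step: the zeros of a window mark the block boundaries, and a window that
  covers the blocks of K letters determines these letters.\<close>
lemma synchronization_step:
  assumes sync: "\<And>i0. \<exists>l\<le>K. \<forall>i. window i K = window i0 K \<longrightarrow> (\<exists>j. i + l = (sub_len ^^ m) j)"
    and K': "\<And>j. sub_len (j + K) - sub_len j + 2 < K'"
  shows "\<exists>l\<le>K'. \<forall>i. window i K' = window i0 K' \<longrightarrow> (\<exists>j. i + l = (sub_len ^^ Suc m) j)"
proof -
  have "\<exists>l0\<le>1. trib_word (i0 + l0) = 0"
  proof (cases i0 rule: sub_len_cases)
    case (1 j)
    then show ?thesis by (intro exI[of _ 0]) simp
  next
    case (2 j)
    then have "i0 + 1 = sub_len (Suc j)" by (simp add: sub_len_Suc)
    then show ?thesis by (intro exI[of _ 1]) simp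
  qed
  then obtain l0 where l0: "l0 \<le> 1" "trib_word (i0 + l0) = 0" by blast
  then obtain j0 where j0: "i0 + l0 = sub_len j0" unfolding trib_word_eq_0_iff by blast
  obtain l' where l': "l' \<le> K" "\<And>i. window i K = window j0 K \<Longrightarrow> \<exists>j. i + l' = (sub_len ^^ m) j"
    using sync[of j0] by blast
  define l where "l = l0 + (sub_len (j0 + l') - sub_len j0)"
  have "sub_len (j0 + l') \<le> sub_len (j0 + K)" using l'(1) by simp
  then have lK: "l \<le> K'" using K'[of j0] l0(1) unfolding l_def by linarith
  have "\<exists>j. i + l = (sub_len ^^ Suc m) j" if w: "window i K' = window i0 K'" for i
  proof -
    have eq: "trib_word (i + x) = trib_word (i0 + x)" if "x < K'" for x
      using w that by (simp add: window_eq_iff)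
    have "l0 < K'" using K'[of 0] l0(1) by simp
    then have "trib_word (i + l0) = 0" using eq l0 by simp
    then obtain j where j: "i + l0 = sub_len j" unfolding trib_word_eq_0_iff by blast
    \<comment> \<open>Aligning at the first 0 costs at most one letter, and
      \<open>desubst_window\<close> reads one letter past the last block start. These are the two
      extra letters in the bound on K'.\<close>
    have "\<forall>x<K' - 1. trib_word (sub_len j0 + x) = trib_word (sub_len j + x)"
    proof (intro allI impI)
      fix x assume "x < K' - 1"
      then have "l0 + x < K'" using l0(1) by simp
      from eq[OF this] show "trib_word (sub_len j0 + x) = trib_word (sub_len j + x)"
        by (simp add: j[symmetric] j0[symmetric] add.assoc)
    qed
    moreover have "Suc (sub_len (j0 + K) - sub_len j0) < K' - 1" using K'[of j0] by simp
    ultimately have "\<forall>x\<le>K. trib_word (j0 + x) = trib_word (j + x)" by (rule desubst_window)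
    then have jj0: "\<forall>x<K. trib_word (j0 + x) = trib_word (j + x)" by simp
    then have "window j K = window j0 K" by (simp add: window_eq_iff)
    then obtain y where y: "j + l' = (sub_len ^^ m) y" using l'(2) by blast
    have "sub_len (j0 + l') - sub_len j0 = sub_len (j + l') - sub_len j"
      using sub_len_window_cong[of l' j0 j] jj0 l'(1) by simp
    then have "i + l = sub_len (j + l')"
      using j sub_len_mono[of j "j + l'"] unfolding l_def by linarith
    then have "i + l = (sub_len ^^ Suc m) y" using y by simp
    then show ?thesis by blast
  qed
  then show ?thesis using lK by blast
qed

text \<open>The level is the last one whose required length is at most h. Required lengths grow like
  the powers of \<beta>, so h is at most a constant times the block length. Windows too short for
  this use level 0, where every position is a boundary.\<close>

lemma synchronization:
  "\<exists>A\<ge>0. \<forall>h i0. \<exists>m l. l \<le> h \<and> real h \<le> A * trib_root ^ m \<and>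
     (\<forall>i. window i h = window i0 h \<longrightarrow> (\<exists>j. i + l = (sub_len ^^ m) j))"
proof -
  obtain C where C: "C \<ge> 0" "\<And>n. \<bar>real (sub_len n) - trib_root * real n\<bar> \<le> C"
    using sub_len_approx by blast
  let ?\<beta> = trib_root
  have \<beta>: "9 / 5 \<le> ?\<beta>" "?\<beta> \<le> 19 / 10" by (rule trib_root_ge, rule trib_root_le)
  \<comment> \<open>A step must absorb 2 C from two length estimates, 2 extra letters and 1 from
    rounding; \<beta> - 1 \<ge> 4/5 makes this A large enough.\<close>
  define A where "A = 4 * C + 6"
  have A: "0 < A" "2 * C + 3 \<le> A * (?\<beta> - 1)"
  proof -
    have "2 * C + 3 \<le> (4 * C + 6) * (4 / 5)" using C(1) by simp
    also have "\<dots> \<le> A * (?\<beta> - 1)" unfolding A_def using C(1) \<beta> by (intro mult_mono) auto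
    finally show "2 * C + 3 \<le> A * (?\<beta> - 1)" .
  qed (use C(1) in \<open>simp add: A_def\<close>)
  \<comment> \<open>The subtracted A creates slack: before rounding, \<beta> times the length at m
    falls short of the length at m + 1 by A times \<beta> - 1.\<close>
  define K where "K m = nat \<lfloor>A * (2 * ?\<beta> ^ m - 1)\<rfloor>" for m
  have K_real: "real (K m) \<le> A * (2 * ?\<beta> ^ m - 1)" "A * (2 * ?\<beta> ^ m - 1) - 1 < real (K m)" for m
  proof -
    have "1 \<le> ?\<beta> ^ m" using \<beta> by (intro one_le_power) auto
    then have "0 \<le> A * (2 * ?\<beta> ^ m - 1)" using A by simp
    then show "real (K m) \<le> A * (2 * ?\<beta> ^ m - 1)" "A * (2 * ?\<beta> ^ m - 1) - 1 < real (K m)"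
      unfolding K_def by linarith+
  qed
  have K_step: "?\<beta> * real (K m) + 2 * C + 2 < real (K (Suc m))" for m
  proof -
    have "?\<beta> * real (K m) \<le> ?\<beta> * (A * (2 * ?\<beta> ^ m - 1))" using K_real(1)[of m] \<beta> by simp
    moreover have "?\<beta> * (A * (2 * ?\<beta> ^ m - 1)) = A * (2 * ?\<beta> ^ Suc m - 1) - A * (?\<beta> - 1)"
      by (simp add: algebra_simps)
    ultimately show ?thesis using A(2) K_real(2)[of "Suc m"] by linarith
  qed
  have step: "sub_len (j + K m) - sub_len j + 2 < K (Suc m)" for j m
  proof -
    have "real (sub_len (j + K m)) - real (sub_len j) \<le> ?\<beta> * real (K m) + 2 * C"
      using C(2)[of "j + K m"] C(2)[of j] by (simp add: algebra_simps)
    then have "real (sub_len (j + K m) - sub_len j + 2) < real (K (Suc m))"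
      using K_step[of m] sub_len_mono[of j "j + K m"] by (simp add: of_nat_diff del: sub_len_le_iff)
    then show ?thesis by linarith
  qed
  define sync where "sync m h i0 \<longleftrightarrow> (\<exists>l\<le>h. \<forall>i. window i h = window i0 h \<longrightarrow> (\<exists>j. i + l = (sub_len ^^ m) j))" for m h i0
  have sync0: "sync 0 h i0" for h i0 unfolding sync_def by (intro exI[of _ 0]) simp
  have sync: "sync m (K m) i0" for m i0
  proof (induction m arbitrary: i0)
    case (Suc m)
    show ?case unfolding sync_def
      by (rule synchronization_step[of "K m"]) (use Suc step in \<open>auto simp: sync_def\<close>)
  qed (rule sync0)
  have K_mono: "m + K 0 \<le> K m" for m
  proof (induction m)
    case (Suc m)
    have "real (K m) \<le> ?\<beta> * real (K m)" using \<beta> by (simp add: mult_le_cancel_right1)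
    then have "real (K m) < real (K (Suc m))" using K_step[of m] C(1) by linarith
    then show ?case using Suc by linarith
  qed simp
  have "\<exists>m l. l \<le> h \<and> real h \<le> 4 * A * ?\<beta> ^ m \<and>
     (\<forall>i. window i h = window i0 h \<longrightarrow> (\<exists>j. i + l = (sub_len ^^ m) j))" for h i0
  proof (cases "h < K 0")
    case True
    then have "real h \<le> 4 * A * ?\<beta> ^ 0" using K_real(1)[of 0] A(1) by simp
    then show ?thesis using sync0[of h i0] unfolding sync_def by blast
  next
    case False
    have "h < K (Suc h)" using K_mono[of "Suc h"] by simp
    then obtain m where m: "K m \<le> h" "h < K (Suc m)"
      using ex_least_nat_less[of "\<lambda>m. h < K m" "Suc h"] False by (auto simp: not_less)
    have "real h \<le> A * (2 * ?\<beta> ^ Suc m - 1)" using m(2) K_real(1)[of "Suc m"] by linarith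
    also have "\<dots> \<le> A * (4 * ?\<beta> ^ m)"
    proof (rule mult_left_mono)
      have "2 * ?\<beta> * ?\<beta> ^ m \<le> 4 * ?\<beta> ^ m" using \<beta> by (intro mult_right_mono) auto
      then show "2 * ?\<beta> ^ Suc m - 1 \<le> 4 * ?\<beta> ^ m" by simp
    qed (use A in simp)
    finally have "real h \<le> 4 * A * ?\<beta> ^ m" by simp
    moreover obtain l where l: "l \<le> K m"
      "\<And>i. window i (K m) = window i0 (K m) \<Longrightarrow> \<exists>j. i + l = (sub_len ^^ m) j"
      using sync[of m i0] unfolding sync_def by blast
    moreover have "\<exists>j. i + l = (sub_len ^^ m) j" if "window i h = window i0 h" for i
    proof (rule l(2))
      show "window i (K m) = window i0 (K m)" using that m(1) by (simp add: window_eq_iff)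
    qed
    moreover have "l \<le> h" using l(1) m(1) by simp
    ultimately show ?thesis by blast
  qed
  then show ?thesis using A(1) by (intro exI[of _ "4 * A"]) auto
qed

subsection \<open>Rigidity of long windows\<close>

text \<open>Signed, because the second position may lie to the left of the first.\<close>

definition count_diff :: "nat \<Rightarrow> nat \<Rightarrow> nat \<Rightarrow> int" where
  "count_diff a x y = int (letter_count a y) - int (letter_count a x)"

lemma count_diff_sum: "int y - int x = count_diff 0 x y + count_diff 1 x y + count_diff 2 x y"
  using letter_count_sum[of x] letter_count_sum[of y] unfolding count_diff_def by linarith

lemma count_diff_window: "window i h = window j h \<Longrightarrow> r \<le> h \<Longrightarrow> count_diff a i (i + r) = count_diff a j (j + r)"
  unfolding count_diff_def by (rule letter_count_window_cong) (auto simp: window_eq_iff)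

text \<open>Letter counts of an image are the incidence matrix applied to the counts before, so
  counts between block indices determine the counts, and hence the distance, between block
  starts.\<close>

lemma count_diff_sub_len_pow:
  assumes "\<forall>a\<le>2. count_diff a x x' = count_diff a y y'"
  shows "\<forall>a\<le>2. count_diff a ((sub_len ^^ m) x) ((sub_len ^^ m) x') =
    count_diff a ((sub_len ^^ m) y) ((sub_len ^^ m) y')"
proof (induction m)
  case (Suc m)
  have *: "count_diff 0 (sub_len u) (sub_len v) = int v - int u"
    "count_diff 1 (sub_len u) (sub_len v) = count_diff 0 u v"
    "count_diff 2 (sub_len u) (sub_len v) = count_diff 1 u v" for u v
    unfolding count_diff_def letter_count_sub_len by simp_all
  let ?C = "\<lambda>a m. count_diff a ((sub_len ^^ m) x) ((sub_len ^^ m) x')"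
  let ?D = "\<lambda>a m. count_diff a ((sub_len ^^ m) y) ((sub_len ^^ m) y')"
  have IH: "?C 0 m = ?D 0 m" "?C 1 m = ?D 1 m" "?C 2 m = ?D 2 m" using Suc by auto
  have "?C 0 (Suc m) = ?D 0 (Suc m)" "?C 1 (Suc m) = ?D 1 (Suc m)" "?C 2 (Suc m) = ?D 2 (Suc m)"
    unfolding funpow.simps comp_apply * count_diff_sum IH by simp_all
  moreover have "a = 0 \<or> a = 1 \<or> a = 2" if "a \<le> 2" for a :: nat using that by auto
  ultimately show ?case by blast
qed (use assms in simp)

lemma card_le_of_factor:
  assumes "finite K" "f ` T \<subseteq> K" "\<And>s t. s \<in> T \<Longrightarrow> t \<in> T \<Longrightarrow> f s = f t \<Longrightarrow> g s = g t"
  shows "finite (g ` T)" "card (g ` T) \<le> card K"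
proof -
  define \<phi> where "\<phi> k = g (SOME t. t \<in> T \<and> f t = k)" for k
  have "g t = \<phi> (f t)" if "t \<in> T" for t
  proof -
    have "(SOME s. s \<in> T \<and> f s = f t) \<in> T \<and> f (SOME s. s \<in> T \<and> f s = f t) = f t"
      by (rule someI[of _ t]) (use that in simp)
    then show ?thesis unfolding \<phi>_def using assms(3) that by metis
  qed
  then have sub: "g ` T \<subseteq> \<phi> ` K" using assms(2) by force
  show "finite (g ` T)" using sub assms(1) finite_subset by blast
  have "card (g ` T) \<le> card (\<phi> ` K)" using sub assms(1) by (intro card_mono) auto
  also have "\<dots> \<le> card K" by (rule card_image_le[OF assms(1)])
  finally show "card (g ` T) \<le> card K" .
qed

lemma card_int_ball:
  fixes y R :: real assumes "0 \<le> R"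
  shows "finite {z::int. \<bar>real_of_int z - y\<bar> \<le> R}" "card {z::int. \<bar>real_of_int z - y\<bar> \<le> R} \<le> nat \<lfloor>2 * R\<rfloor> + 1"
proof -
  have "{z::int. \<bar>real_of_int z - y\<bar> \<le> R} = {\<lceil>y - R\<rceil>..\<lfloor>y + R\<rfloor>}"
    by (auto simp: abs_le_iff ceiling_le_iff le_floor_iff)
  moreover have "nat (\<lfloor>y + R\<rfloor> + 1 - \<lceil>y - R\<rceil>) \<le> nat \<lfloor>2 * R\<rfloor> + 1"
    using assms by linarith
  ultimately show "finite {z::int. \<bar>real_of_int z - y\<bar> \<le> R}"
    "card {z::int. \<bar>real_of_int z - y\<bar> \<le> R} \<le> nat \<lfloor>2 * R\<rfloor> + 1" by auto
qed

lemma sub_len_pow_strict_mono: "strict_mono (sub_len ^^ m)"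
  by (induction m) (auto simp: strict_mono_def)

lemma sub_len_pow_0 [simp]: "(sub_len ^^ m) 0 = 0"
  by (induction m) auto

lemma sub_len_pow_block: "\<exists>j. (sub_len ^^ m) j \<le> x \<and> x < (sub_len ^^ m) (Suc j)"
proof -
  have "Suc x \<le> (sub_len ^^ m) (Suc x)"
    using sub_len_pow_strict_mono by (rule strict_mono_imp_increasing)
  then show ?thesis
    using ex_least_nat_less[of "\<lambda>j. x < (sub_len ^^ m) j" "Suc x"] by (auto simp: not_less)
qed

text \<open>If the window at i is known, then i has a known offset to a block boundary
  of a level whose blocks are as long as the window. At this scale the position i + e is
  within bounded distance, so up to bounded choice everything around it is known.\<close>
lemma window_rigidity:
  "\<exists>B. \<forall>h (e::int) p.
     finite ((\<lambda>(i, i'). (window i' h, count_diff 0 i i', count_diff 1 i i')) ` {(i, i'). window i h = p \<and> int i' = int i + e}) \<and>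
     card ((\<lambda>(i, i'). (window i' h, count_diff 0 i i', count_diff 1 i i')) ` {(i, i'). window i h = p \<and> int i' = int i + e}) \<le> B"
proof -
  let ?\<beta> = trib_root
  have \<beta>: "9 / 5 \<le> ?\<beta>" by (rule trib_root_ge)
  obtain A where A: "A \<ge> 0" "\<And>h i0. \<exists>m l. l \<le> h \<and> real h \<le> A * ?\<beta> ^ m \<and>
     (\<forall>i. window i h = window i0 h \<longrightarrow> (\<exists>j. i + l = (sub_len ^^ m) j))"
    using synchronization by blast
  obtain C where C: "C \<ge> 0"
    "\<And>m x. \<bar>real ((sub_len ^^ m) x) - ?\<beta> ^ m * real x\<bar> \<le> C * ?\<beta> ^ m"
    using sub_len_pow_approx by blast
  obtain C3 f where C3: "C3 \<ge> 0" "\<And>a n. a \<le> 2 \<Longrightarrow> \<bar>real (letter_count a n) - f a * real n\<bar> \<le> C3"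
    using letter_count_approx by blast
  \<comment> \<open>N blocks cover the target window: it starts at most 1 + 2 C into its block and
    has length at most A, both in units of the power of \<beta>, while N blocks have length at least
    N - 2 C.\<close>
  define N where "N = nat \<lceil>1 + 4 * C + A\<rceil>"
  \<comment> \<open>Two count estimates err by C3 each, and the distance of the block indices
    differs from its expected value \<open>x0\<close> by at most 1 + 4 C.\<close>
  define R where "R = 2 * C3 + (\<bar>f 0\<bar> + \<bar>f 1\<bar> + \<bar>f 2\<bar>) * (1 + 4 * C)"
  have R: "0 \<le> R" using C(1) C3(1) by (simp add: R_def)
  define M where "M = nat \<lfloor>2 * R\<rfloor> + 1"
  let ?T = "\<lambda>h e p. {(i, i'). window i h = p \<and> int i' = int i + (e::int)}"
  let ?g = "\<lambda>h (i, i'). (window i' h, count_diff 0 i i', count_diff 1 i i')"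
  have "finite (?g h ` ?T h e p) \<and> card (?g h ` ?T h e p) \<le> M * (M * (M * 3 ^ N))" for h e p
  proof (cases "\<exists>i0. window i0 h = p")
    case False
    then have "?T h e p = {}" by auto
    then show ?thesis by (simp only: image_empty card.empty finite.emptyI le0 simp_thms)
  next
    case True
    then obtain i0 where p: "p = window i0 h" by blast
    obtain m l where ml: "l \<le> h" "real h \<le> A * ?\<beta> ^ m"
      "\<And>i. window i h = p \<Longrightarrow> \<exists>j. i + l = (sub_len ^^ m) j"
      using A(2)[of h i0] unfolding p by blast
    let ?S = "sub_len ^^ m"
    have bpos: "0 < ?\<beta> ^ m" using \<beta> by simp
    define J where "J i = (SOME j. i + l = ?S j)" for i
    have J: "i + l = ?S (J i)" if "window i h = p" for i
      unfolding J_def by (rule someI_ex, rule ml(3)[OF that])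
    define J' where "J' x = (SOME j. ?S j \<le> x \<and> x < ?S (Suc j))" for x
    have J': "?S (J' x) \<le> x" "x < ?S (Suc (J' x))" for x
      using someI_ex[OF sub_len_pow_block[of m x]] unfolding J'_def by blast+
    have Sdiff: "\<bar>(real (?S y) - real (?S x)) - ?\<beta> ^ m * (real y - real x)\<bar> \<le> 2 * C * ?\<beta> ^ m" for x y
      using C(2)[of m x] C(2)[of m y] by (simp add: algebra_simps)
    have block: "real x - real (?S (J' x)) \<le> (1 + 2 * C) * ?\<beta> ^ m" for x
      using Sdiff[of "Suc (J' x)" "J' x"] J'(2)[of x] by (simp add: algebra_simps)
    define key where "key = (\<lambda>(i, i'). (count_diff 0 (J i) (J' i'), count_diff 1 (J i) (J' i'),
      count_diff 2 (J i) (J' i'), window (J' i') N))"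
    define x0 where "x0 = (real_of_int e - real l) / ?\<beta> ^ m"
    define ballz where "ballz a = {z::int. \<bar>real_of_int z - f a * x0\<bar> \<le> R}" for a :: nat
    have near: "\<bar>real (J' i') - real (J i) - x0\<bar> \<le> 1 + 4 * C" if "(i, i') \<in> ?T h e p" for i i'
    proof -
      have w: "window i h = p" and e: "int i' = int i + e" using that by auto
      have r: "real i' = real i + real_of_int e" using e by linarith
      have "real i + real l = real (?S (J i))" using J[OF w] by linarith
      moreover have "0 \<le> real i' - real (?S (J' i'))" using J'(1)[of i'] by simp
      ultimately have "\<bar>?\<beta> ^ m * (real (J' i') - real (J i)) - (real_of_int e - real l)\<bar> \<le> (1 + 4 * C) * ?\<beta> ^ m"
        using r block[of i'] Sdiff[of "J' i'" "J i"] by (simp add: algebra_simps abs_le_iff)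
      also have "?\<beta> ^ m * (real (J' i') - real (J i)) - (real_of_int e - real l)
          = (real (J' i') - real (J i) - x0) * ?\<beta> ^ m"
      proof -
        have "?\<beta> ^ m \<noteq> 0" using bpos by linarith
        from nonzero_eq_divide_eq[OF this, THEN iffD1, OF refl]
        have "x0 * ?\<beta> ^ m = real_of_int e - real l" unfolding x0_def .
        then show ?thesis unfolding left_diff_distrib by (simp add: algebra_simps)
      qed
      finally show ?thesis using bpos by (simp add: abs_mult)
    qed
    have inball: "count_diff a (J i) (J' i') \<in> ballz a" if T: "(i, i') \<in> ?T h e p" and a: "a \<le> 2" for i i' a
    proof -
      have "a = 0 \<or> a = 1 \<or> a = 2" using a by auto
      then have fa: "\<bar>f a\<bar> \<le> \<bar>f 0\<bar> + \<bar>f 1\<bar> + \<bar>f 2\<bar>" by (elim disjE) simp_all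
      have "\<bar>f a * (real (J' i') - real (J i) - x0)\<bar> \<le> (\<bar>f 0\<bar> + \<bar>f 1\<bar> + \<bar>f 2\<bar>) * (1 + 4 * C)"
        unfolding abs_mult using fa near[OF T] by (intro mult_mono) auto
      then show ?thesis
        using C3(2)[OF a, of "J i"] C3(2)[OF a, of "J' i'"]
        by (simp add: ballz_def count_diff_def R_def algebra_simps abs_le_iff)
    qed
    define Keys where "Keys = ballz 0 \<times> ballz 1 \<times> ballz 2 \<times> range (\<lambda>i. window i N)"
    have finK: "finite Keys" unfolding Keys_def ballz_def
      using card_int_ball(1)[OF R] finite_windows by (intro finite_cartesian_product) auto
    have ball: "card (ballz a) \<le> M" for a unfolding ballz_def M_def by (rule card_int_ball(2)[OF R])
    have cardK: "card Keys \<le> M * (M * (M * 3 ^ N))"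
      unfolding Keys_def card_cartesian_product by (intro mult_le_mono ball card_windows_le)
    have keys: "key ` ?T h e p \<subseteq> Keys"
    proof (rule image_subsetI)
      fix s assume s: "s \<in> ?T h e p"
      obtain i i' where ii: "s = (i, i')" by (cases s)
      show "key s \<in> Keys"
        using inball[OF s[unfolded ii], of 0] inball[OF s[unfolded ii], of 1] inball[OF s[unfolded ii], of 2]
        unfolding key_def Keys_def ii by simp
    qed
    \<comment> \<open>The counts between the block indices fix the offset of i' in its block, and
      then the N letters fix the window at i'. The counts from i to i' are the sum of those from i
      to i + l, between the block starts, and from there to i'.\<close>
    have det: "?g h s = ?g h t" if s: "s \<in> ?T h e p" and t: "t \<in> ?T h e p" and st: "key s = key t" for s t
    proof -
      obtain i i' where ii: "s = (i, i')" "window i h = p" "int i' = int i + e" using s by auto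
      obtain k k' where kk: "t = (k, k')" "window k h = p" "int k' = int k + e" using t by auto
      have cd: "\<forall>a\<le>2. count_diff a (J i) (J' i') = count_diff a (J k) (J' k')"
      proof (intro allI impI)
        fix a :: nat assume "a \<le> 2"
        then have "a = 0 \<or> a = 1 \<or> a = 2" by auto
        then show "count_diff a (J i) (J' i') = count_diff a (J k) (J' k')"
          using st unfolding key_def ii kk by auto
      qed
      note cS = count_diff_sub_len_pow[OF cd, of m]
      have Sd: "int (?S (J' i')) - int (?S (J i)) = int (?S (J' k')) - int (?S (J k))"
        using cS unfolding count_diff_sum by simp
      define r where "r = i' - ?S (J' i')"
      have i': "i' = ?S (J' i') + r" using J'(1)[of i'] by (simp add: r_def)
      have k': "k' = ?S (J' k') + r"
        using Sd J[OF ii(2)] J[OF kk(2)] ii(3) kk(3) i' by linarith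
      have wJ: "\<forall>x<N. trib_word (J' i' + x) = trib_word (J' k' + x)"
        using st unfolding key_def ii kk window_eq_iff[symmetric] by simp
      define len where "len = ?S (J' i' + N) - ?S (J' i')"
      have wS: "window (?S (J' i')) len = window (?S (J' k')) len"
        unfolding window_eq_iff len_def using sub_len_pow_window_cong[OF wJ, of m] by blast
      have "r + h \<le> len"
      proof -
        have "real r \<le> (1 + 2 * C) * ?\<beta> ^ m" using block[of i'] i' by linarith
        then have "real (r + h) \<le> (1 + 2 * C + A) * ?\<beta> ^ m" using ml(2) by (simp add: algebra_simps)
        also have "\<dots> \<le> (real N - 2 * C) * ?\<beta> ^ m"
          by (rule mult_right_mono) (use bpos in \<open>auto simp: N_def\<close>, linarith)
        also have "\<dots> \<le> real (?S (J' i' + N)) - real (?S (J' i'))"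
          using Sdiff[of "J' i' + N" "J' i'"] by (simp add: algebra_simps)
        finally have "real (?S (J' i')) + real (r + h) \<le> real (?S (J' i' + N))" by linarith
        then show ?thesis unfolding len_def by linarith
      qed
      then have "window i' h = window k' h"
        using wS unfolding window_eq_iff by (subst i', subst k') (simp add: add.assoc)
      moreover have "count_diff a i i' = count_diff a k k'" if "a \<le> 2" for a
      proof -
        have "count_diff a i i' = count_diff a i (i + l) + count_diff a (?S (J i)) (?S (J' i')) + count_diff a (?S (J' i')) i'"
          unfolding J[OF ii(2)] by (simp add: count_diff_def)
        also have "count_diff a i (i + l) = count_diff a k (k + l)"
          by (rule count_diff_window[OF _ ml(1)]) (simp add: ii kk)
        also have "count_diff a (?S (J i)) (?S (J' i')) = count_diff a (?S (J k)) (?S (J' k'))"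
          using cS that by blast
        also have "count_diff a (?S (J' i')) i' = count_diff a (?S (J' k')) k'"
        proof -
          have "count_diff a (?S (J' i')) (?S (J' i') + r) = count_diff a (?S (J' k')) (?S (J' k') + r)"
            by (rule count_diff_window[OF wS]) (use \<open>r + h \<le> len\<close> in simp)
          then show ?thesis by (simp only: i'[symmetric] k'[symmetric])
        qed
        finally show ?thesis unfolding J[OF kk(2)] by (simp add: count_diff_def)
      qed
      ultimately show ?thesis unfolding ii kk by simp
    qed
    have "finite (?g h ` ?T h e p)" "card (?g h ` ?T h e p) \<le> card Keys"
      by (rule card_le_of_factor[OF finK keys], erule (2) det)+
    then show ?thesis using cardK by (intro conjI order_trans[OF _ cardK])
  qed
  then show ?thesis by blast
qed

lemma card_le_Sigma:
  assumes inj: "inj_on f Y" and sub: "f ` Y \<subseteq> (SIGMA p:Q. S p \<times> {0, 1, 2::nat} \<times> {0, 1, 2::nat})"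
    and Q: "finite Q" "card Q \<le> 2" and S: "\<And>p. finite (S p)" "\<And>p. card (S p) \<le> B"
  shows "finite Y \<and> card Y \<le> 18 * B"
proof -
  let ?X = "SIGMA p:Q. S p \<times> {0, 1, 2::nat} \<times> {0, 1, 2::nat}"
  have fin: "finite ?X" using Q S by (intro finite_SigmaI) auto
  have "card ?X = (\<Sum>p\<in>Q. card (S p \<times> {0, 1, 2::nat} \<times> {0, 1, 2::nat}))"
    using Q S by (intro card_SigmaI) auto
  also have "\<dots> \<le> (\<Sum>p\<in>Q. B * 9)"
  proof (rule sum_mono)
    fix p
    have "card (S p \<times> {0, 1, 2::nat} \<times> {0, 1, 2::nat}) = card (S p) * 9"
      unfolding card_cartesian_product by simp
    then show "card (S p \<times> {0, 1, 2::nat} \<times> {0, 1, 2::nat}) \<le> B * 9" using S(2)[of p] by linarith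
  qed
  also have "\<dots> \<le> 18 * B" using Q(2) by simp
  finally have "card ?X \<le> 18 * B" .
  moreover have "card Y \<le> card ?X" using inj sub fin by (rule card_inj_on_le)
  moreover have "finite Y" using inj sub fin by (rule inj_on_finite)
  ultimately show ?thesis by linarith
qed

text \<open>One of the two windows has at most two values; rigidity then bounds the other window and
  the counts, and the two extra letters have three values each. If the right window is the special
  one, rigidity is applied with the negative distance.\<close>

lemma special_bound:
  "\<exists>B. \<forall>h d u v Y Q.
     inj_on (\<lambda>i. (window i h, window (i + d) h, count_diff 0 i (i + d), count_diff 1 i (i + d),
        trib_word (u i), trib_word (v i))) Y \<longrightarrow> finite Q \<longrightarrow> card Q \<le> 2 \<longrightarrow>
     (\<forall>i\<in>Y. window i h \<in> Q) \<or> (\<forall>i\<in>Y. window (i + d) h \<in> Q) \<longrightarrow> finite Y \<and> card Y \<le> B"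
proof -
  define S where "S h e p = (\<lambda>(i, i'). (window i' h, count_diff 0 i i', count_diff 1 i i')) `
    {(i, i'). window i h = p \<and> int i' = int i + (e::int)}" for h e p
  obtain B where B: "\<And>h e p. finite (S h e p)" "\<And>h e p. card (S h e p) \<le> B"
    using window_rigidity unfolding S_def by blast
  have SI: "(window i' h, count_diff 0 i i', count_diff 1 i i') \<in> S h e p"
    if "window i h = p" "int i' = int i + e" for i i' h e p
    unfolding S_def using that by (intro image_eqI[of _ _ "(i, i')"]) auto
  have "finite Y \<and> card Y \<le> 18 * B"
    if inj: "inj_on (\<lambda>i. (window i h, window (i + d) h, count_diff 0 i (i + d), count_diff 1 i (i + d),
        trib_word (u i), trib_word (v i))) Y" and Q: "finite Q" "card Q \<le> 2"
      and special: "(\<forall>i\<in>Y. window i h \<in> Q) \<or> (\<forall>i\<in>Y. window (i + d) h \<in> Q)" for h d u v Y Q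
    using special
  proof
    assume Y: "\<forall>i\<in>Y. window i h \<in> Q"
    let ?f = "\<lambda>i. (window i h, (window (i + d) h, count_diff 0 i (i + d), count_diff 1 i (i + d)),
        trib_word (u i), trib_word (v i))"
    show ?thesis
    proof (rule card_le_Sigma[of ?f Y Q "S h (int d)", OF _ _ Q B])
      show "inj_on ?f Y" using inj unfolding inj_on_def by simp
      show "?f ` Y \<subseteq> (SIGMA p:Q. S h (int d) p \<times> {0, 1, 2} \<times> {0, 1, 2})"
        by (intro image_subsetI SigmaI SI trib_word_mem) (use Y in auto)
    qed
  next
    assume Y: "\<forall>i\<in>Y. window (i + d) h \<in> Q"
    let ?f = "\<lambda>i. (window (i + d) h, (window i h, count_diff 0 (i + d) i, count_diff 1 (i + d) i),
        trib_word (u i), trib_word (v i))"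
    show ?thesis
    proof (rule card_le_Sigma[of ?f Y Q "S h (- int d)", OF _ _ Q B])
      have neg: "count_diff a (i + d) i = - count_diff a i (i + d)" for a i by (simp add: count_diff_def)
      show "inj_on ?f Y" using inj unfolding inj_on_def neg by simp
      show "?f ` Y \<subseteq> (SIGMA p:Q. S h (- int d) p \<times> {0, 1, 2} \<times> {0, 1, 2})"
        by (intro image_subsetI SigmaI SI trib_word_mem) (use Y in auto)
    qed
  qed
  then show ?thesis by blast
qed

subsection \<open>Bounded differences of complexities\<close>

lemma kab_congI:
  assumes "\<And>l. l < n \<Longrightarrow> l + 1 < k \<or> n < l + k \<Longrightarrow> trib_word (i + l) = trib_word (j + l)"
    and "count_diff 0 i (i + n) = count_diff 0 j (j + n)" "count_diff 1 i (i + n) = count_diff 1 j (j + n)"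
  shows "kab_cong k n i j"
  using assms unfolding kab_cong_def count_diff_def by auto

lemma kab_cong_Suc: "kab_cong (Suc k) n i j \<Longrightarrow> kab_cong k n i j"
  unfolding kab_cong_def by auto

text \<open>Cutting off the last letter shortens the known suffix by one, for which the larger k
  makes up. As k \<ge> 1, that letter agrees, so the letter counts remain equal.\<close>

lemma kab_cong_Suc_Suc:
  assumes "1 \<le> k" "kab_cong (Suc k) (Suc n) i j" shows "kab_cong k n i j"
proof -
  have "trib_word (i + n) = trib_word (j + n)" using assms unfolding kab_cong_def by auto
  then show ?thesis using assms(2) unfolding kab_cong_def by (auto simp: letter_count_Suc)
qed

lemma right_special_window:
  "window i h = window j h \<Longrightarrow> trib_word (i + h) \<noteq> trib_word (j + h) \<Longrightarrow> right_special (window i h)"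
  unfolding right_special_def by (intro exI[of _ i] exI[of _ j]) simp

lemma min_reps_unique: "i \<in> min_reps k n \<Longrightarrow> j \<in> min_reps k n \<Longrightarrow> kab_cong k n i j \<Longrightarrow> i = j"
  using kab_cong_sym[of k n i j] unfolding min_reps_def by (cases i j rule: linorder_cases) auto

lemma min_reps_diffE:
  assumes "i \<in> min_reps k' n' - min_reps k n"
  obtains j where "kab_cong k n i j" "\<not> kab_cong k' n' i j"
  using assms unfolding min_reps_def by blast

text \<open>A class splits when k grows only if its prefix of length k - 1 is right
  special or its suffix of that length is left special.\<close>
lemma min_reps_diff_bound: "\<exists>B. \<forall>k n. card (min_reps (Suc k) n - min_reps k n) \<le> B"
proof -
  obtain B where B: "\<forall>h d u v Y Q.
     inj_on (\<lambda>i. (window i h, window (i + d) h, count_diff 0 i (i + d), count_diff 1 i (i + d),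
        trib_word (u i), trib_word (v i))) Y \<longrightarrow> finite Q \<longrightarrow> card Q \<le> 2 \<longrightarrow>
     (\<forall>i\<in>Y. window i h \<in> Q) \<or> (\<forall>i\<in>Y. window (i + d) h \<in> Q) \<longrightarrow> finite Y \<and> card Y \<le> B"
    using special_bound by (rule exE)
  have "card (min_reps (Suc k) n - min_reps k n) \<le> B + B" for k n
  proof (cases "1 \<le> k \<and> k \<le> n")
    case False
    \<comment> \<open>For k > n the whole windows are compared already, and for k = 0 neither k nor
      k + 1 compares any letter by position.\<close>
    have "kab_cong (Suc k) n i j" if "kab_cong k n i j" for i j
      using that False unfolding kab_cong_def by auto
    then have "min_reps (Suc k) n - min_reps k n = {}" using min_reps_diffE by blast
    then show ?thesis by (simp only: card.empty le0)
  next
    case True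
    then have k: "1 \<le> k" and kn: "k \<le> n" by auto
    define h where "h = k - 1"
    define d where "d = n - h"
    have hd: "k = Suc h" "n = d + h" "1 \<le> d" using k kn by (auto simp: h_def d_def)
    define X where "X = min_reps (Suc k) n - min_reps k n"
    define X1 where "X1 = {i \<in> X. right_special (window i h)}"
    define X2 where "X2 = {i \<in> X. window (i + d) h = window 0 h}"
    \<comment> \<open>The two letters are what the step to k + 1 adds: the one after the known
      prefix and the one before the known suffix.\<close>
    let ?key = "\<lambda>i. (window i h, window (i + d) h, count_diff 0 i (i + d), count_diff 1 i (i + d),
      trib_word (i + h), trib_word (i + d - 1))"
    have cong: "kab_cong (Suc k) n i j" if key: "?key i = ?key j" for i j
    proof (rule kab_congI)
      fix l assume l: "l < n" "l + 1 < Suc k \<or> n < l + Suc k"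
      then consider "l < h" | "l = h" | "l = d - 1" | x where "l = d + x" "x < h"
      proof -
        have "l < h \<or> l = h \<or> l = d - 1 \<or> l = d + (l - d) \<and> l - d < h" using l hd by auto
        then show ?thesis using that by metis
      qed
      then show "trib_word (i + l) = trib_word (j + l)"
      proof cases
        case 3
        then show ?thesis using key hd(3) by simp
      next
        case (4 x)
        then show ?thesis using key by (simp add: window_eq_iff add.assoc)
      qed (use key in \<open>auto simp: window_eq_iff\<close>)
    next
      have "count_diff a (i + d) (i + d + h) = count_diff a (j + d) (j + d + h)" for a
        by (rule count_diff_window[of _ h]) (use key in simp_all)
      moreover have "count_diff a x (x + n) = count_diff a x (x + d) + count_diff a (x + d) (x + d + h)" for a x
        using hd(2) by (simp add: count_diff_def add.assoc)
      ultimately show "count_diff 0 i (i + n) = count_diff 0 j (j + n)" "count_diff 1 i (i + n) = count_diff 1 j (j + n)"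
        using key by simp_all
    qed
    have inj: "inj_on ?key X"
    proof (rule inj_onI)
      fix i j assume "i \<in> X" "j \<in> X" "?key i = ?key j"
      then show "i = j" using cong min_reps_unique[of i "Suc k" n j] unfolding X_def by blast
    qed
    have inj1: "inj_on ?key X1" and inj2: "inj_on ?key X2"
      by (rule inj_on_subset[OF inj], force simp: X1_def X2_def)+
    have "X \<subseteq> X1 \<union> X2"
    proof
      fix i assume i: "i \<in> X"
      then obtain j where j: "kab_cong k n i j" "\<not> kab_cong (Suc k) n i j"
        unfolding X_def by (rule min_reps_diffE)
      have wi: "window i h = window j h" and wd: "window (i + d) h = window (j + d) h"
        using j(1) hd unfolding kab_cong_def window_eq_iff by (auto simp: add.assoc)
      from j obtain l where l: "l < n" "l < k \<or> n < l + Suc k" "trib_word (i + l) \<noteq> trib_word (j + l)"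
        "\<not> (l + 1 < k \<or> n < l + k)"
        unfolding kab_cong_def by auto
      then have "l = h \<or> l = d - 1" using hd by auto
      then show "i \<in> X1 \<union> X2"
      proof
        assume "l = h"
        then have "i \<in> X1" using right_special_window[OF wi] l(3) i by (simp add: X1_def)
        then show ?thesis ..
      next
        assume ld: "l = d - 1"
        have S: "Suc (i + l) = i + d" "Suc (j + l) = j + d" using ld hd(3) by auto
        have "\<forall>x<h. trib_word (Suc (i + l) + x) = trib_word x"
          using left_special_prefix[OF l(3), of h] wd unfolding S window_eq_iff by blast
        then have "i \<in> X2" using i unfolding X2_def S by (simp add: window_eq_iff)
        then show ?thesis ..
      qed
    qed
    moreover have "finite X1 \<and> card X1 \<le> B"
      by (rule B[rule_format, OF inj1 right_special_card[of h]]) (auto simp: X1_def)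
    moreover have "finite X2 \<and> card X2 \<le> B"
      by (rule B[rule_format, OF inj2, of "{window 0 h}"]) (auto simp: X2_def)
    ultimately have "card X \<le> B + B"
      by (meson add_mono card_Un_le card_mono finite_UnI order_trans)
    then show ?thesis by (simp add: X_def)
  qed
  then show ?thesis by blast
qed

text \<open>Here both causes of splitting are extensions to the right, by the letter after the known
  prefix and by the new last letter, so only right special windows occur.\<close>

lemma min_reps_diff_Suc_bound:
  "\<exists>B. \<forall>k n. 1 \<le> k \<longrightarrow> card (min_reps (Suc k) (Suc n) - min_reps k n) \<le> B"
proof -
  obtain B where B: "\<forall>h d u v Y Q.
     inj_on (\<lambda>i. (window i h, window (i + d) h, count_diff 0 i (i + d), count_diff 1 i (i + d),
        trib_word (u i), trib_word (v i))) Y \<longrightarrow> finite Q \<longrightarrow> card Q \<le> 2 \<longrightarrow>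
     (\<forall>i\<in>Y. window i h \<in> Q) \<or> (\<forall>i\<in>Y. window (i + d) h \<in> Q) \<longrightarrow> finite Y \<and> card Y \<le> B"
    using special_bound by (rule exE)
  have "card (min_reps (Suc k) (Suc n) - min_reps k n) \<le> B + B" if k: "1 \<le> k" for k n
  proof -
    define h where "h = min (k - 1) n"
    define d where "d = n - h"
    have hd: "h < k" "n = d + h" "h = k - 1 \<or> d = 0" using k by (auto simp: h_def d_def)
    define X where "X = min_reps (Suc k) (Suc n) - min_reps k n"
    define X1 where "X1 = {i \<in> X. right_special (window i h)}"
    define X2 where "X2 = {i \<in> X. right_special (window (i + d) h)}"
    let ?key = "\<lambda>i. (window i h, window (i + d) h, count_diff 0 i (i + d), count_diff 1 i (i + d),
      trib_word (i + h), trib_word (i + n))"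
    have cong: "kab_cong (Suc k) (Suc n) i j" if key: "?key i = ?key j" for i j
    proof (rule kab_congI)
      fix l assume l: "l < Suc n" "l + 1 < Suc k \<or> Suc n < l + Suc k"
      then consider "l < h" | "l = h" | "l = n" | x where "l = d + x" "x < h"
      proof -
        have "l < h \<or> l = h \<or> l = n \<or> l = d + (l - d) \<and> l - d < h" using l hd by auto
        then show ?thesis using that by metis
      qed
      then show "trib_word (i + l) = trib_word (j + l)"
      proof cases
        case (4 x)
        then show ?thesis using key by (simp add: window_eq_iff add.assoc)
      qed (use key in \<open>auto simp: window_eq_iff\<close>)
    next
      have "count_diff a (i + d) (i + d + h) = count_diff a (j + d) (j + d + h)" for a
        by (rule count_diff_window[of _ h]) (use key in simp_all)
      moreover have "count_diff a (i + n) (i + Suc n) = count_diff a (j + n) (j + Suc n)" for a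
        using key by (simp add: count_diff_def letter_count_Suc)
      moreover have "count_diff a x (x + Suc n) = count_diff a x (x + d) + count_diff a (x + d) (x + d + h)
          + count_diff a (x + n) (x + Suc n)" for a x
        using hd(2) by (simp add: count_diff_def add.assoc)
      ultimately show "count_diff 0 i (i + Suc n) = count_diff 0 j (j + Suc n)"
        "count_diff 1 i (i + Suc n) = count_diff 1 j (j + Suc n)"
        using key by (metis (no_types) prod.inject)+
    qed
    have inj: "inj_on ?key X"
    proof (rule inj_onI)
      fix i j assume "i \<in> X" "j \<in> X" "?key i = ?key j"
      then show "i = j" using cong min_reps_unique[of i "Suc k" "Suc n" j] unfolding X_def by blast
    qed
    have inj1: "inj_on ?key X1" and inj2: "inj_on ?key X2"
      by (rule inj_on_subset[OF inj], force simp: X1_def X2_def)+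
    have "X \<subseteq> X1 \<union> X2"
    proof
      fix i assume i: "i \<in> X"
      then obtain j where j: "kab_cong k n i j" "\<not> kab_cong (Suc k) (Suc n) i j"
        unfolding X_def by (rule min_reps_diffE)
      have wi: "window i h = window j h" and wd: "window (i + d) h = window (j + d) h"
        using j(1) hd unfolding kab_cong_def window_eq_iff by (auto simp: add.assoc)
      show "i \<in> X1 \<union> X2"
      proof (cases "trib_word (i + n) = trib_word (j + n)")
        case False
        have "i + n = i + d + h" "j + n = j + d + h" using hd(2) by simp_all
        then have "right_special (window (i + d) h)" using right_special_window[OF wd] False by metis
        then show ?thesis using i by (simp add: X2_def)
      next
        case True
        with j obtain l where l: "l < Suc n" "l < k \<or> n < l + k" "trib_word (i + l) \<noteq> trib_word (j + l)"
          unfolding kab_cong_def by (auto simp: letter_count_Suc)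
        have "l \<noteq> n" using l(3) True by metis
        then have "\<not> (l + 1 < k \<or> n < l + k)" using l j(1) unfolding kab_cong_def by auto
        then have "l = h" using l hd \<open>l \<noteq> n\<close> by auto
        then have "i \<in> X1" using right_special_window[OF wi] l(3) i by (simp add: X1_def)
        then show ?thesis ..
      qed
    qed
    moreover have "finite X1 \<and> card X1 \<le> B"
      by (rule B[rule_format, OF inj1 right_special_card[of h]]) (auto simp: X1_def)
    moreover have "finite X2 \<and> card X2 \<le> B"
      by (rule B[rule_format, OF inj2 right_special_card[of h]]) (auto simp: X2_def)
    ultimately have "card X \<le> B + B"
      by (meson add_mono card_Un_le card_mono finite_UnI order_trans)
    then show ?thesis by (simp add: X_def)
  qed
  then show ?thesis by blast
qed

lemma kab_complexity_diff_k:
  assumes "1 \<le> k"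
  shows "int (kab_complexity trib_word (k + 1) n) - int (kab_complexity trib_word k n) =
    int (card (min_reps (Suc k) n - min_reps k n))"
proof -
  have sub: "min_reps k n \<subseteq> min_reps (Suc k) n" using kab_cong_Suc unfolding min_reps_def by blast
  then show ?thesis
    using assms card_mono[OF finite_min_reps sub]
    by (simp add: kab_complexity_eq_card card_Diff_subset finite_min_reps of_nat_diff)
qed

text \<open>The equivalence at (k, n + 1) need not refine the one at (k, n), since cutting off the
  last letter loses a letter of the known suffix. Both are refined by the one at (k + 1, n + 1),
  through which the difference is taken.\<close>

lemma kab_complexity_diff_n:
  assumes "1 \<le> k"
  shows "int (kab_complexity trib_word k (n + 1)) - int (kab_complexity trib_word k n) =
    int (card (min_reps (Suc k) (Suc n) - min_reps k n)) -
    int (card (min_reps (Suc k) (Suc n) - min_reps k (Suc n)))"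
proof -
  have 1: "min_reps k (Suc n) \<subseteq> min_reps (Suc k) (Suc n)" using kab_cong_Suc unfolding min_reps_def by blast
  have 2: "min_reps k n \<subseteq> min_reps (Suc k) (Suc n)"
    using kab_cong_Suc_Suc[OF assms] unfolding min_reps_def by blast
  show ?thesis
    using assms card_mono[OF finite_min_reps 1] card_mono[OF finite_min_reps 2] 1 2
    by (simp add: kab_complexity_eq_card card_Diff_subset finite_min_reps of_nat_diff)
qed

subsection \<open>Recognizability of the level sets\<close>

text \<open>As \<open>sub_len\<close> enumerates the zeros, the count before n is the least z with n
  \<le> \<open>sub_len z\<close>.\<close>

lemma definable_letter_count_0:
  assumes "definable f" shows "definable (\<lambda>r. letter_count 0 (f r))"
proof (rule definable_comp[OF _ assms])
  have "n \<le> sub_len (letter_count 0 n)" for n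
    by (cases n rule: sub_len_cases) (auto simp: letter_count_sub_len letter_count_Suc sub_len_Suc)
  moreover have "letter_count 0 n \<le> y" if "n \<le> sub_len y" for n y
    using letter_count_mono[OF that, of 0] by (simp add: letter_count_sub_len)
  ultimately have "letter_count 0 n = z \<longleftrightarrow> n \<le> sub_len z \<and> (\<forall>y. n \<le> sub_len y \<longrightarrow> z \<le> y)" for n z
    by (metis le_antisym)
  moreover have "recog (\<lambda>r. r 1 \<le> sub_len (r 0) \<and> (\<forall>y. r 1 \<le> sub_len y \<longrightarrow> r 0 \<le> y))"
    by (intro recog_intros)
  ultimately show "recog (\<lambda>r. letter_count 0 (r 1) = r 0)" by simp
qed

text \<open>Blocks containing a 1 are the images of zeros, and within a block the 1 comes second; so
  the ones before n are the zeros before the index of the block of n.\<close>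

lemma definable_letter_count_1:
  assumes "definable f" shows "definable (\<lambda>r. letter_count 1 (f r))"
proof (rule definable_comp[OF _ assms])
  have *: "letter_count 1 n = letter_count 0 j" if "sub_len j \<le> n" "n < sub_len (Suc j)" for n j
  proof -
    have "n = sub_len j \<or> n = Suc (sub_len j)" using that by (auto simp: sub_len_Suc split: if_splits)
    then show ?thesis using letter_count_sub_len(2)[of j] by (auto simp: letter_count_Suc)
  qed
  have "\<exists>j. sub_len j \<le> n \<and> n < sub_len (Suc j)" for n
    using sub_len_pow_block[of 1 n] by simp
  then have "letter_count 1 n = z \<longleftrightarrow> (\<exists>j. sub_len j \<le> n \<and> n < sub_len (Suc j) \<and> letter_count 0 j = z)" for n z
    using * by metis
  moreover have "recog (\<lambda>r. \<exists>j. sub_len j \<le> r 1 \<and> r 1 < sub_len (Suc j) \<and> letter_count 0 j = r 0)"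
    by (intro recog_intros definable_letter_count_0)
  ultimately show "recog (\<lambda>r. letter_count 1 (r 1) = r 0)" by simp
qed

lemma recog_trib_word_eq:
  assumes "definable f" "definable g" shows "recog (\<lambda>r. trib_word (f r) = trib_word (g r))"
proof -
  have "trib_word x = trib_word y \<longleftrightarrow> (trib_word x = 0 \<longleftrightarrow> trib_word y = 0) \<and> (trib_word x = 1 \<longleftrightarrow> trib_word y = 1)" for x y
    using trib_word_cases[of x] trib_word_cases[of y] by auto
  then have *: "trib_word x = trib_word y \<longleftrightarrow> ((\<exists>j. x = sub_len j) \<longleftrightarrow> (\<exists>j. y = sub_len j)) \<and>
      ((\<exists>j. x = Suc (sub_len (sub_len j))) \<longleftrightarrow> (\<exists>j. y = Suc (sub_len (sub_len j))))" for x y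
    unfolding trib_word_eq_0_iff trib_word_eq_1_iff .
  show ?thesis unfolding *
    by (intro recog_intros) (rule definable_rename[OF assms(1)] definable_rename[OF assms(2)])+
qed

lemma recog_kab_cong:
  assumes "definable k" "definable n" "definable i" "definable j"
  shows "recog (\<lambda>r. kab_cong (k r) (n r) (i r) (j r))"
  unfolding kab_cong_def
  by (intro recog_intros recog_trib_word_eq definable_letter_count_0 definable_letter_count_1 assms)
    (rule assms[THEN definable_rename])+

lemma recog_card_min_reps_diff:
  assumes "definable k'" "definable n'" "definable k" "definable n"
  shows "recog (\<lambda>r. card (min_reps (k' r) (n' r) - min_reps (k r) (n r)) = c)"
proof -
  have "recog (\<lambda>r. card {i. (\<forall>j. j < i \<longrightarrow> \<not> kab_cong (k' r) (n' r) i j) \<and>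
      \<not> (\<forall>j. j < i \<longrightarrow> \<not> kab_cong (k r) (n r) i j)} = c)"
  proof (rule recog_card)
    show "recog (\<lambda>r. (\<forall>j. j < r 0 \<longrightarrow> \<not> kab_cong (k' (\<lambda>x. r (Suc x))) (n' (\<lambda>x. r (Suc x))) (r 0) j) \<and>
        \<not> (\<forall>j. j < r 0 \<longrightarrow> \<not> kab_cong (k (\<lambda>x. r (Suc x))) (n (\<lambda>x. r (Suc x))) (r 0) j))"
      by (intro recog_conj recog_all recog_not recog_imp recog_less recog_kab_cong definable_var)
        (rule assms[THEN definable_rename])+
    show "finite {i. (\<forall>j. j < i \<longrightarrow> \<not> kab_cong (k' r) (n' r) i j) \<and>
        \<not> (\<forall>j. j < i \<longrightarrow> \<not> kab_cong (k r) (n r) i j)}" for r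
      by (rule finite_subset[OF _ finite_min_reps[of "k' r" "n' r"]]) (auto simp: min_reps_def)
  qed
  moreover have "{i. (\<forall>j. j < i \<longrightarrow> \<not> kab_cong k' n' i j) \<and> \<not> (\<forall>j. j < i \<longrightarrow> \<not> kab_cong k n i j)}
      = min_reps k' n' - min_reps k n" for k' n' k n
    by (auto simp: min_reps_def)
  ultimately show ?thesis by simp
qed

lemma recog_int_eq:
  assumes "\<And>c. recog (\<lambda>r. f r = c)" shows "recog (\<lambda>r. int (f r) = c)"
proof (cases "0 \<le> c")
  case True
  then have "int x = c \<longleftrightarrow> x = nat c" for x by auto
  then show ?thesis using assms[of "nat c"] by simp
next
  case False
  then have "int x = c \<longleftrightarrow> \<not> (0 \<le> x)" for x by auto
  then show ?thesis using recog_not[OF recog_le[OF definable_0 definable_0]] by simp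
qed

lemma recog_finite_ex:
  assumes "finite A" "\<And>y. y \<in> A \<Longrightarrow> recog (P y)" shows "recog (\<lambda>r. \<exists>y\<in>A. P y r)"
  using assms
proof (induction A)
  case empty
  show ?case using recog_not[OF recog_le[OF definable_0 definable_0]] by simp
next
  case (insert x A)
  then have "recog (\<lambda>r. P x r \<or> (\<exists>y\<in>A. P y r))" by (intro recog_disj) auto
  then show ?case by simp
qed

lemma trib_automatic2_cong:
  assumes "trib_automatic2 D f" "\<And>k n. D k n \<Longrightarrow> g k n = f k n" shows "trib_automatic2 D g"
proof -
  obtain Q :: "nat set" and q0 delta out where
    "finite Q" "q0 \<in> Q" "\<forall>q\<in>Q. \<forall>a b. a \<in> {0,1} \<longrightarrow> b \<in> {0,1} \<longrightarrow> delta q (a, b) \<in> Q"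
    "\<forall>k n u v. D k n \<longrightarrow> trib_valid u \<longrightarrow> trib_valid v \<longrightarrow> length u = length v \<longrightarrow>
            trib_val u = k \<longrightarrow> trib_val v = n \<longrightarrow> out (foldl delta q0 (zip u v)) = f k n"
    using assms(1) unfolding trib_automatic2_def by (elim exE conjE)
  then show ?thesis unfolding trib_automatic2_def
    by (intro exI[of _ Q] exI[of _ q0] exI[of _ delta] exI[of _ out]) (simp add: assms(2))
qed

theorem theorem20:
  shows "trib_automatic2 (\<lambda>k n. 1 \<le> k)
           (\<lambda>k n. int (kab_complexity trib_word (k + 1) n) - int (kab_complexity trib_word k n))
       \<and> trib_automatic2 (\<lambda>k n. 1 \<le> k)
           (\<lambda>k n. int (kab_complexity trib_word k (n + 1)) - int (kab_complexity trib_word k n))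
       \<and> (\<exists>B. \<forall>k n. 1 \<le> k \<longrightarrow>
            \<bar>int (kab_complexity trib_word (k + 1) n) - int (kab_complexity trib_word k n)\<bar> \<le> B)
       \<and> (\<exists>B. \<forall>k n. 1 \<le> k \<longrightarrow>
            \<bar>int (kab_complexity trib_word k (n + 1)) - int (kab_complexity trib_word k n)\<bar> \<le> B)"
proof -
  define f where "f k n = card (min_reps (Suc k) n - min_reps k n)" for k n
  define g where "g k n = card (min_reps (Suc k) (Suc n) - min_reps k n)" for k n
  define F where "F k n = int (f k n)" for k n
  define G where "G k n = int (g k n) - int (f k (Suc n))" for k n
  obtain B1 B2 where B: "\<And>k n. f k n \<le> B1" "\<And>k n. 1 \<le> k \<Longrightarrow> g k n \<le> B2"
    using min_reps_diff_bound min_reps_diff_Suc_bound unfolding f_def g_def by meson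
  have F: "int (kab_complexity trib_word (k + 1) n) - int (kab_complexity trib_word k n) = F k n"
    if "1 \<le> k" for k n
    using kab_complexity_diff_k[OF that] by (simp add: F_def f_def)
  have G: "int (kab_complexity trib_word k (n + 1)) - int (kab_complexity trib_word k n) = G k n"
    if "1 \<le> k" for k n
    using kab_complexity_diff_n[OF that] by (simp add: G_def f_def g_def)
  have boundF: "\<bar>F k n\<bar> \<le> int B1" if "1 \<le> k" for k n
    using B(1) by (simp add: F_def)
  have boundG: "\<bar>G k n\<bar> \<le> int (B1 + B2)" if "1 \<le> k" for k n
    using B(1)[of k "Suc n"] B(2)[OF that, of n] by (simp add: G_def)
  have recf: "recog (\<lambda>r. f (k r) (n r) = c)" and recg: "recog (\<lambda>r. g (k r) (n r) = c)"
    if "definable k" "definable n" for k n c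
    unfolding f_def g_def by (intro recog_card_min_reps_diff definable_Suc that)+
  have recF: "recog (\<lambda>r. F (r 0) (r 1) = c)" for c
    unfolding F_def by (intro recog_int_eq recf definable_var)
  \<comment> \<open>The bound on f turns the subtraction into a finite disjunction over the values
    of the second count.\<close>
  have "G k n = c \<longleftrightarrow> (\<exists>y\<in>{..B1}. f k (Suc n) = y \<and> int (g k n) = c + int y)" for k n c
    using B(1)[of k "Suc n"] by (auto simp: G_def)
  moreover have "recog (\<lambda>r. \<exists>y\<in>{..B1}. f (r 0) (Suc (r 1)) = y \<and> int (g (r 0) (r 1)) = c + int y)" for c
    by (intro recog_finite_ex recog_conj recog_int_eq recf recg definable_Suc definable_var) simp
  ultimately have recG: "recog (\<lambda>r. G (r 0) (r 1) = c)" for c by simp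
  have autF: "trib_automatic2 (\<lambda>k n. 1 \<le> k) F" and autG: "trib_automatic2 (\<lambda>k n. 1 \<le> k) G"
    by (rule trib_automatic2I[OF recF boundF], assumption, rule trib_automatic2I[OF recG boundG], assumption)
  show ?thesis
  proof (intro conjI)
    show "\<exists>B. \<forall>k n. 1 \<le> k \<longrightarrow>
        \<bar>int (kab_complexity trib_word (k + 1) n) - int (kab_complexity trib_word k n)\<bar> \<le> B"
      using F boundF by metis
    show "\<exists>B. \<forall>k n. 1 \<le> k \<longrightarrow>
        \<bar>int (kab_complexity trib_word k (n + 1)) - int (kab_complexity trib_word k n)\<bar> \<le> B"
      using G boundG by metis
  qed (rule trib_automatic2_cong[OF autF F] trib_automatic2_cong[OF autG G], assumption)+
qed

end
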